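(* Let $P(z,w)=\sum P_{n,m}z^nw^m$ be the unique formal power series with $P=1+\frac{wzP^2}{1-z^3P^2}$, and let $Q_{n,m}$ be as in the context. For $n>0$, $P_{n,m}$ and $Q_{n,m}$ are $0$ unless $m=n-3k$ for some integer $k$ with $0\le k<n/3$, in which case $$P_{n,n-3k}=\frac{1}{n-k+1}\binom{n-2k-1}{k}\binom{2n-4k}{n-3k},$$ $$Q_{n,n-3k}=\sum_{s=0}^{k}\frac{3(k-s)+2}{n-s+1}\binom{n-3k+s-2}{s}\binom{2n-3k-s-1}{n-3k-1}.$$
   Context: For $n\ge1$, fix a convex $(n+2)$-gon with vertices labelled $0,\dots,n+1$ in cyclic order. A dissection is a set of pairwise non-crossing diagonals (chords); they partition the polygon into sub-polygons (cells). The quiddity of a dissection is the tuple $(a_0,\dots,a_{n+1})$, $a_i$ being the number of cells having vertex $i$. A dissection is 3-periodic if every cell has a number of vertices divisible by $3$. $Q_{n,m}$ is the number of distinct tuples occurring as quiddities of 3-periodic dissections of the $(n+2)$-gon into exactly $m$ cells. *)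

theory Defs
  imports "HOL-Computational_Algebra.Formal_Power_Series"
begin

text \<open>
  A convex polygon is given by the finite set of its vertex labels, in the cyclic order induced
  by the order of the natural numbers.  The chord joining two vertices is encoded as the ordered
  pair of its endpoints, the smaller one first.  A sub-polygon is given by its set of vertices.
\<close>

type_synonym chord = "nat \<times> nat"

definition chords :: "nat set \<Rightarrow> chord set" where
  "chords V = {(i, j). i \<in> V \<and> j \<in> V \<and> i < j}"

text \<open>
  A chord is a side iff its endpoints are cyclically consecutive in \<open>V\<close>: one of the two open arcs
  between them contains no vertex of \<open>V\<close>.
\<close>

definition sides :: "nat set \<Rightarrow> chord set" where
  "sides V = {(i, j) \<in> chords V. V \<inter> {i<..<j} = {} \<or> V \<subseteq> {i..j}}"

definition diagonals :: "nat set \<Rightarrow> chord set" where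
  "diagonals V = chords V - sides V"

fun crossing :: "chord \<Rightarrow> chord \<Rightarrow> bool" where
  "crossing (i, j) (k, l) \<longleftrightarrow> i < k \<and> k < j \<and> j < l \<or> k < i \<and> i < l \<and> l < j"

definition polygon :: "nat \<Rightarrow> nat set" where
  "polygon n = {0..n + 1}"

definition dissection :: "nat \<Rightarrow> chord set \<Rightarrow> bool" where
  "dissection n D \<longleftrightarrow> D \<subseteq> diagonals (polygon n) \<and> (\<forall>c\<in>D. \<forall>d\<in>D. \<not> crossing c d)"

text \<open>
  The cells of a dissection are the sub-polygons all of whose sides are sides of the big polygon
  or diagonals of the dissection, and which are not cut any further by the dissection.
  (A chord entering the interior of such a sub-polygon without crossing one of its sides
  has to be one of its diagonals.)
\<close>

definition cells :: "nat \<Rightarrow> chord set \<Rightarrow> nat set set" where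
  "cells n D = {C. C \<subseteq> polygon n \<and> 3 \<le> card C \<and>
     sides C \<subseteq> sides (polygon n) \<union> D \<and> diagonals C \<inter> D = {}}"

definition quiddity :: "nat \<Rightarrow> chord set \<Rightarrow> nat list" where
  "quiddity n D = map (\<lambda>i. card {C \<in> cells n D. i \<in> C}) [0..<n + 2]"

definition three_periodic :: "nat \<Rightarrow> chord set \<Rightarrow> bool" where
  "three_periodic n D \<longleftrightarrow> (\<forall>C\<in>cells n D. 3 dvd card C)"

definition Q :: "nat \<Rightarrow> nat \<Rightarrow> nat" where
  "Q n m = card {quiddity n D | D. dissection n D \<and> three_periodic n D \<and> card (cells n D) = m}"

text \<open>
  Series in \<open>z\<close> and \<open>w\<close> are series in \<open>z\<close> over the series in \<open>w\<close>, so that \<open>fps_nth (fps_nth P n) m\<close> is the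
  coefficient of \<open>z\<^sup>n w\<^sup>m\<close>.  The division below is by a series in \<open>z\<close> with constant term 1,
  hence by a unit.
\<close>

definition P_equation :: "rat fps fps \<Rightarrow> bool" where
  "P_equation P \<longleftrightarrow>
    (let z = fps_X; w = fps_const fps_X in P = 1 + w * z * P ^ 2 / (1 - z ^ 3 * P ^ 2))"

end

theory Submission
  imports Defs
begin

unbundle fps_syntax

text \<open>
  Write \<open>PSL(2,Z)\<close> as the free product of \<open>\<langle>S\<rangle>\<close> of order 2 and \<open>\<langle>U\<rangle>\<close> of order 3, and put \<open>T = US\<close>.
  A tuple \<open>a\<close> of positive integers is the quiddity of a 3-periodic dissection iff the product of
  the \<open>T\<^bsup>a\<^sub>i - 1\<^esup> U\<close> is trivial: gluing a cell with \<open>3r\<close> vertices to a side inserts a factor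
  \<open>S U\<^bsup>3r\<^esup> S\<close>, and conversely the normal form of a trivial product containing \<open>S\<close> can only collapse
  at such a factor, where a cell can be cut off.  So quiddities correspond to closed walks on a tree
  of triangles.  The walks inside a branch of the tree have the generating function \<open>V = z P\<close>, where
  \<open>V = z + w V\<^sup>2 / (1 - z V\<^sup>2)\<close>, and the closed walks give
  \<open>\<Sum> Q\<^bsub>n,m\<^esub> z\<^sup>n w\<^sup>m = w z P\<^sup>2 / (1 - z\<^sup>3 P\<^sup>3)\<close>.  The coefficients of the powers of \<open>P\<close> are determined by the
  linear recurrence \<open>P\<^bsup>p+1\<^esup> = P\<^sup>p + z\<^sup>3 (P\<^bsup>p+3\<^esup> - P\<^bsup>p+2\<^esup>) + w z P\<^bsup>p+2\<^esup>\<close>, which the closed formula satisfies.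
\<close>

section \<open>Powers of the series\<close>

lemma fps_X_power_dvd_iff_nth:
  fixes f :: "'a::comm_ring_1 fps"
  shows "fps_X ^ n dvd f \<longleftrightarrow> (\<forall>i<n. f $ i = 0)"
proof
  assume "fps_X ^ n dvd f"
  then obtain g where "f = fps_X ^ n * g" by (auto simp: dvd_def)
  then show "\<forall>i<n. f $ i = 0" by (simp add: fps_X_power_mult_nth)
next
  assume "\<forall>i<n. f $ i = 0"
  then have "f = fps_X ^ n * fps_shift n f"
    by (intro fps_ext) (simp add: fps_X_power_mult_nth)
  then show "fps_X ^ n dvd f" by (metis dvd_triv_left)
qed

text \<open>Banach's fixed point argument in the X-adic metric, where divisibility of a difference
  by \<open>fps_X ^ n\<close> measures closeness: iterating from 0 settles one more coefficient at
  each stage.\<close>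

lemma fps_contraction_fixpoint:
  fixes \<Phi> :: "'a::comm_ring_1 fps \<Rightarrow> 'a fps"
  assumes contr: "\<And>f g n. fps_X ^ n dvd f - g \<Longrightarrow> fps_X ^ Suc n dvd \<Phi> f - \<Phi> g"
  shows "\<exists>!f. f = \<Phi> f"
proof -
  have eqI: "f = g" if *: "\<And>n. fps_X ^ n dvd f - g" for f g :: "'a fps"
  proof (rule fps_ext)
    fix n
    have "(f - g) $ n = 0"
      using *[of "Suc n"] unfolding fps_X_power_dvd_iff_nth by blast
    then show "f $ n = g $ n" by simp
  qed
  define F where "F k = (\<Phi> ^^ k) 0" for k
  have F_Suc: "F (Suc k) = \<Phi> (F k)" for k by (simp add: F_def)
  have step: "fps_X ^ k dvd F (Suc k) - F k" for k
  proof (induction k)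
    case (Suc k)
    from contr[OF this] show ?case by (simp only: F_Suc)
  qed simp
  have mono: "fps_X ^ k dvd F (k + d) - F k" for k d
  proof (induction d)
    case (Suc d)
    have "fps_X ^ k dvd F (Suc (k + d)) - F (k + d)"
      using dvd_trans[OF le_imp_power_dvd step[of "k + d"], of k] by simp
    from dvd_add[OF this Suc] show ?case by simp
  qed simp
  \<comment> \<open>The coefficient of index \<open>n\<close> no longer changes from the iterate
    \<open>F (Suc n)\<close> on.\<close>
  define f where "f = Abs_fps (\<lambda>n. F (Suc n) $ n)"
  have lim: "fps_X ^ k dvd f - F k" for k
    unfolding fps_X_power_dvd_iff_nth
  proof safe
    fix i assume "i < k"
    then obtain d where k: "k = Suc i + d" using less_iff_Suc_add by auto
    have "(F (Suc i + d) - F (Suc i)) $ i = 0"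
      using mono[of "Suc i" d] unfolding fps_X_power_dvd_iff_nth by blast
    then show "(f - F k) $ i = 0" by (simp add: f_def k)
  qed
  have "fps_X ^ n dvd f - \<Phi> f" for n
  proof (cases n)
    case (Suc k)
    have "fps_X ^ n dvd (f - F (Suc k)) - (\<Phi> f - \<Phi> (F k))"
      unfolding Suc by (rule dvd_diff[OF lim contr[OF lim]])
    then show ?thesis by (simp add: F_Suc)
  qed simp
  then have ex: "f = \<Phi> f" by (rule eqI)
  have "g = f" if g: "g = \<Phi> g" for g
  proof (rule eqI)
    show "fps_X ^ n dvd g - f" for n
    proof (induction n)
      case (Suc n)
      from contr[OF this] show ?case unfolding g[symmetric] ex[symmetric] .
    qed simp
  qed
  with ex show ?thesis by blast
qed

text \<open>The coefficients are series in w and do not form a field, so invertibility rests on the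
  constant term 1, which is its own inverse.\<close>

lemma fps_mult_inverse_unit:
  fixes u :: "rat fps fps"
  assumes "u $ 0 = 1"
  shows "u * inverse u = 1"
proof -
  have "inverse u = fps_right_inverse u 1"
    by (subst fps_inverse_def) (simp add: assms)
  then show ?thesis by (simp add: fps_right_inverse assms)
qed

lemma fps_divide_eq_mult_inverse:
  fixes u :: "rat fps fps"
  assumes "u $ 0 = 1"
  shows "f / u = f * inverse u"
  using assms by (intro fps_divide_unit) simp

definition P_rhs :: "rat fps fps \<Rightarrow> rat fps fps" where
  "P_rhs P = 1 + fps_const fps_X * fps_X * (P ^ 2 * inverse (1 - fps_X ^ 3 * P ^ 2))"

lemma P_den_nth_0: "(1 - fps_X ^ 3 * P ^ 2 :: rat fps fps) $ 0 = 1"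
  by (simp add: power3_eq_cube mult.assoc)

lemma P_equation_iff: "P_equation P \<longleftrightarrow> P = P_rhs P"
  unfolding P_equation_def P_rhs_def Let_def
  by (simp add: fps_divide_eq_mult_inverse[OF P_den_nth_0] mult.assoc)

text \<open>The two fractions differ by a multiple of \<open>f - g\<close>, because the cross terms
  with \<open>fps_X ^ 3\<close> cancel; the prefactor \<open>fps_X\<close> then raises the order by
  one.\<close>

lemma P_rhs_contraction:
  assumes "fps_X ^ n dvd f - g"
  shows "fps_X ^ Suc n dvd P_rhs f - P_rhs g"
proof -
  define u v :: "rat fps fps" where "u = 1 - fps_X ^ 3 * f ^ 2" and "v = 1 - fps_X ^ 3 * g ^ 2"
  have uv: "u * inverse u = 1" "v * inverse v = 1"
    unfolding u_def v_def by (rule fps_mult_inverse_unit[OF P_den_nth_0])+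
  have "f ^ 2 * inverse u - g ^ 2 * inverse v
      = f ^ 2 * inverse u * (v * inverse v) - g ^ 2 * inverse v * (u * inverse u)"
    by (simp only: uv mult_1_right)
  also have "\<dots> = (f ^ 2 * v - g ^ 2 * u) * (inverse u * inverse v)"
    by (simp only: left_diff_distrib right_diff_distrib mult_ac)
  finally have 1: "f ^ 2 * inverse u - g ^ 2 * inverse v = (f ^ 2 * v - g ^ 2 * u) * (inverse u * inverse v)" .
  have 2: "f ^ 2 * v - g ^ 2 * u = (f - g) * (f + g)"
    by (simp add: u_def v_def algebra_simps power2_eq_square)
  have "P_rhs f - P_rhs g = fps_const fps_X * fps_X * (f ^ 2 * inverse u - g ^ 2 * inverse v)"
    unfolding P_rhs_def u_def[symmetric] v_def[symmetric]
    by (simp only: right_diff_distrib add_diff_cancel_left)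
  then have eq: "P_rhs f - P_rhs g
      = fps_X * (f - g) * (fps_const fps_X * (f + g) * (inverse u * inverse v))"
    unfolding 1 2 by (simp only: mult_ac)
  have "fps_X ^ Suc n dvd fps_X * (f - g)"
    using mult_dvd_mono[OF dvd_refl assms, of fps_X] by simp
  then show ?thesis unfolding eq by (rule dvd_mult2)
qed

lemma ex1_P_equation: "\<exists>!P. P_equation P"
  unfolding P_equation_iff by (rule fps_contraction_fixpoint) (rule P_rhs_contraction)

text \<open>Clear the denominator in the defining equation and multiply by \<open>P ^ p\<close>.
  Powers above \<open>P ^ p\<close> occur on the right only behind a factor \<open>fps_X\<close>, so
  this determines all coefficients recursively.\<close>

lemma P_equation_power_Suc:
  assumes "P_equation P"
  shows "P ^ Suc p = P ^ p + fps_X ^ 3 * (P ^ (p + 3) - P ^ (p + 2))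
           + fps_const fps_X * (fps_X * P ^ (p + 2))"
proof -
  define u where "u = 1 - fps_X ^ 3 * P ^ 2"
  have "u * inverse u = 1"
    unfolding u_def by (rule fps_mult_inverse_unit[OF P_den_nth_0])
  moreover have "P - 1 = fps_const fps_X * fps_X * (P ^ 2 * inverse u)"
    using assms unfolding P_equation_iff u_def by (metis P_rhs_def add_diff_cancel_left')
  ultimately have "(P - 1) * u = fps_const fps_X * fps_X * P ^ 2"
    by (simp add: mult.assoc) (simp add: mult.commute)
  then have "P ^ p * ((P - 1) * u) = P ^ p * (fps_const fps_X * fps_X * P ^ 2)" by simp
  then show ?thesis
    by (simp add: u_def algebra_simps power_add power2_eq_square power3_eq_cube)
qed

text \<open>Lagrange inversion in w, applied to Y = P - 1 = w z (1+Y)^2 / (1 - z^3 (1+Y)^2),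
  predicts this value for the coefficient of z^(m+3i) w^m in P^p. The case \<open>m = 0\<close>,
  where the formula would divide by 0, is given separately.\<close>

definition power_coeff :: "nat \<Rightarrow> nat \<Rightarrow> nat \<Rightarrow> rat" where
  "power_coeff p m i = (if m = 0 then (if i = 0 then 1 else 0) else
     of_nat p / of_nat m * of_nat ((m - 1 + i) choose i)
       * of_nat ((p + 2 * m + 2 * i - 1) choose (m - 1)))"

lemma of_nat_binomial_absorption:
  "of_nat (Suc k) * of_nat (n choose Suc k) = (of_nat n * of_nat ((n - 1) choose k) :: rat)"
  by (metis binomial_absorption of_nat_mult)

lemma of_nat_binomial_step:
  assumes "k \<le> n"
  shows "of_nat (Suc k) * of_nat (n choose Suc k) = (of_nat n - of_nat k) * (of_nat (n choose k) :: rat)"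
  using binomial_absorb_comp[of n k] binomial_absorption[of k n] assms
  by (metis of_nat_diff of_nat_mult)

text \<open>The recurrence for \<open>P ^ Suc p\<close>, read at z^(m+3i) w^m. For
  \<open>m > 1\<close> all terms are multiples of one common factor, which leaves a polynomial
  identity.\<close>

lemma power_coeff_rec:
  assumes "m > 0"
  shows "power_coeff (Suc p) m i = power_coeff p m i
     + (if i = 0 then 0 else power_coeff (p + 3) m (i - 1) - power_coeff (p + 2) m (i - 1))
     + power_coeff (p + 2) (m - 1) i"
proof (cases "m = 1")
  case True
  then show ?thesis by (cases i) (auto simp: power_coeff_def)
next
  case False
  with assms obtain k where m: "m = Suc (Suc k)" by (metis One_nat_def Suc_pred neq0_conv zero_less_diff)
  \<comment> \<open>\<open>L\<close> and \<open>L - 1\<close> are the upper indices of the second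
    binomial for \<open>Suc p\<close> and \<open>p\<close>. Below, \<open>K\<close> equals
    \<open>m - 1\<close>; it becomes a denominator, hence the separate case
    \<open>m = 1\<close>.\<close>
  define L where "L = p + 2 * m + 2 * i"
  define X c :: rat where "X = of_nat ((L - 1) choose k)" and "c = of_nat ((k + i) choose i)"
  define K I q :: rat where "K = of_nat k + 1" and "I = of_nat i" and "q = of_nat p"
  have K0: "K > 0" "K + 1 > 0" unfolding K_def by simp_all
  have L1: "L \<ge> 1" by (simp add: L_def m)
  have Lr: "(of_nat L :: rat) = q + 2 * (K + 1) + 2 * I" by (simp add: L_def m K_def I_def q_def)
  have XL: "of_nat (L choose Suc k) = X * of_nat L / K"
    using of_nat_binomial_absorption[of k L] K0 by (simp add: field_simps K_def X_def)
  have XL1: "of_nat ((L - 1) choose Suc k) = X * (of_nat L - K) / K"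
    using of_nat_binomial_step[of k "L - 1"] K0 L1
    by (simp add: field_simps K_def X_def of_nat_diff L_def m)
  have c1: "of_nat ((Suc k + i) choose i) = c * (K + I) / K"
  proof -
    have "Suc k * ((Suc k + i) choose i) = (Suc k + i) * ((k + i) choose i)"
      using binomial_absorb_comp[of "Suc k + i" i] by (simp add: mult.commute)
    then have "of_nat (Suc k) * of_nat ((Suc k + i) choose i)
        = (of_nat (Suc k + i) * of_nat ((k + i) choose i) :: rat)"
      by (metis of_nat_mult)
    then show ?thesis using K0 by (simp add: field_simps K_def I_def c_def)
  qed
  have lhs: "power_coeff (Suc p) m i = (q + 1) / (K + 1) * (c * (K + I) / K) * (X * of_nat L / K)"
    unfolding power_coeff_def XL[symmetric] c1[symmetric]
    by (simp add: m L_def q_def K_def add.commute)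
  have t1: "power_coeff p m i = q / (K + 1) * (c * (K + I) / K) * (X * (of_nat L - K) / K)"
    unfolding power_coeff_def XL1[symmetric] c1[symmetric]
    by (simp add: m L_def q_def K_def add.commute)
  have t4: "power_coeff (p + 2) (m - 1) i = (q + 2) / K * c * X"
    unfolding power_coeff_def X_def c_def
    by (simp add: m L_def q_def K_def add.commute)
  have t23: "(if i = 0 then 0 else power_coeff (p + 3) m (i - 1) - power_coeff (p + 2) m (i - 1))
     = (q + 3) / (K + 1) * (c * I / K) * (X * of_nat L / K)
       - (q + 2) / (K + 1) * (c * I / K) * (X * (of_nat L - K) / K)"
  proof (cases i)
    case 0
    then show ?thesis by (simp add: I_def)
  next
    case (Suc j)
    have "Suc j * ((Suc k + j) choose Suc j) = Suc k * ((Suc k + j) choose j)"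
      using binomial_absorb_comp[of "Suc k + j" j] binomial_absorption[of j "Suc k + j"] by simp
    then have "of_nat (Suc j) * of_nat ((Suc k + j) choose Suc j)
        = (of_nat (Suc k) * of_nat ((Suc k + j) choose j) :: rat)"
      by (metis of_nat_mult)
    then have c2: "of_nat ((Suc k + j) choose j) = c * I / K"
      using K0 by (simp add: field_simps K_def I_def c_def Suc)
    have "p + 3 + 2 * m + 2 * (i - 1) - 1 = L" "p + 2 + 2 * m + 2 * (i - 1) - 1 = L - 1"
      by (simp_all add: L_def m Suc)
    then show ?thesis
      unfolding power_coeff_def XL[symmetric] XL1[symmetric] c2[symmetric]
      by (simp add: m q_def K_def Suc add.commute)
  qed
  define F where "F = c * X / ((K + 1) * K * K)"
  have "(q + 2) / K * c * X = F * ((q + 2) * (K + 1) * K)"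
    using K0 by (simp add: F_def)
  \<comment> \<open>The two sides differ by \<open>K\<close> times
    \<open>L - (q + 2 * (K + 1) + 2 * I)\<close>, which vanishes by \<open>Lr\<close>.\<close>
  moreover have "(q + 1) * (K + I) * of_nat L = q * (K + I) * (of_nat L - K)
      + ((q + 3) * I * of_nat L - (q + 2) * I * (of_nat L - K)) + (q + 2) * (K + 1) * K"
    unfolding Lr by (simp add: algebra_simps)
  then have "F * ((q + 1) * (K + I) * of_nat L) = F * (q * (K + I) * (of_nat L - K))
      + (F * ((q + 3) * I * of_nat L) - F * ((q + 2) * I * (of_nat L - K)))
      + F * ((q + 2) * (K + 1) * K)"
    by (simp only: distrib_left right_diff_distrib)
  ultimately show ?thesis
    unfolding lhs t1 t23 t4 by (simp add: F_def mult_ac)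
qed

definition power_nth :: "nat \<Rightarrow> nat \<Rightarrow> nat \<Rightarrow> rat" where
  "power_nth p n m = (if m \<le> n \<and> 3 dvd (n - m) then power_coeff p m ((n - m) div 3) else 0)"

text \<open>Shifts by z^3 and by z w preserve n - m modulo 3. So all terms vanish off the support,
  and on it \<open>power_coeff_rec\<close> applies when \<open>m > 0\<close>.\<close>

lemma power_nth_rec:
  "power_nth (Suc p) n m = power_nth p n m
     + (if n < 3 then 0 else power_nth (p + 3) (n - 3) m - power_nth (p + 2) (n - 3) m)
     + (if n = 0 \<or> m = 0 then 0 else power_nth (p + 2) (n - 1) (m - 1))"
proof (cases "m \<le> n \<and> 3 dvd (n - m)")
  case True
  then obtain i where "n - m = 3 * i" by (auto elim: dvdE)
  with True have n: "n = m + 3 * i" by simp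
  have A: "power_nth r n m = power_coeff r m i" for r by (simp add: power_nth_def n)
  have B: "(if n < 3 then 0 else power_nth r (n - 3) m - power_nth r' (n - 3) m)
      = (if i = 0 then 0 else power_coeff r m (i - 1) - power_coeff r' m (i - 1))" for r r'
  proof (cases i)
    case 0
    then have "n < 3 \<or> \<not> m \<le> n - 3" unfolding n by linarith
    with 0 show ?thesis unfolding power_nth_def by auto
  next
    case (Suc j)
    then have "n - 3 = m + 3 * j" "\<not> n < 3" by (simp_all add: n)
    then show ?thesis by (simp add: power_nth_def Suc)
  qed
  show ?thesis
  proof (cases "m = 0")
    case True
    show ?thesis unfolding A B using True by (simp add: power_coeff_def)
  next
    case False
    then have "n - 1 = (m - 1) + 3 * i" by (simp add: n)
    then have "power_nth r (n - 1) (m - 1) = power_coeff r (m - 1) i" for r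
      by (simp add: power_nth_def)
    then show ?thesis unfolding A B using power_coeff_rec[of m p i] False n by simp
  qed
next
  case False
  have 3: "power_nth r (n - 3) m = 0" if "n \<ge> 3" for r
  proof -
    have "\<not> 3 dvd (n - 3 - m)" if "m \<le> n - 3"
    proof
      assume "3 dvd (n - 3 - m)"
      then have "3 dvd (n - 3 - m) + 3" by (rule dvd_add) simp
      moreover have "(n - 3 - m) + 3 = n - m" using that \<open>n \<ge> 3\<close> by linarith
      ultimately have "3 dvd (n - m)" by (simp only:)
      with False that show False by linarith
    qed
    then show ?thesis unfolding power_nth_def by meson
  qed
  have 1: "power_nth r (n - 1) (m - 1) = 0" if "n > 0" "m > 0" for r
  proof -
    have "n - 1 - (m - 1) = n - m" "m - 1 \<le> n - 1 \<longleftrightarrow> m \<le> n" using that by linarith+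
    then show ?thesis using False unfolding power_nth_def by presburger
  qed
  have 0: "power_nth r n m = 0" for r using False unfolding power_nth_def by meson
  have "(if n < 3 then 0 else power_nth (p + 3) (n - 3) m - power_nth (p + 2) (n - 3) m) = 0"
    using 3[of "p + 3"] 3[of "p + 2"] by (metis diff_self not_le)
  moreover have "(if n = 0 \<or> m = 0 then 0 else power_nth (p + 2) (n - 1) (m - 1)) = 0"
    using 1[of "p + 2"] by (metis neq0_conv)
  ultimately show ?thesis by (simp only: 0 add_0_left)
qed

text \<open>Outer induction on the exponent of z, inner induction on \<open>p\<close>: higher powers
  of \<open>P\<close> enter the recurrence only at smaller exponents of z.\<close>

lemma P_power_nth:
  assumes "P_equation P"
  shows "(P ^ p) $ n $ m = power_nth p n m"
proof (induction n arbitrary: p m rule: less_induct)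
  case (less n)
  show ?case
  proof (induction p arbitrary: m)
    case 0
    show ?case by (auto simp: power_nth_def power_coeff_def fps_one_nth)
  next
    case (Suc p)
    have "(P ^ Suc p) $ n $ m = (P ^ p) $ n $ m
      + (if n < 3 then 0 else (P ^ (p + 3)) $ (n - 3) $ m - (P ^ (p + 2)) $ (n - 3) $ m)
      + (if n = 0 \<or> m = 0 then 0 else (P ^ (p + 2)) $ (n - 1) $ (m - 1))"
      by (subst P_equation_power_Suc[OF assms])
        (simp only: fps_add_nth fps_sub_nth fps_X_power_mult_nth fps_X_mult_nth
          fps_mult_left_const_nth, simp)
    then show ?case
      unfolding power_nth_rec[of p n m] using Suc less
      by (simp del: power_Suc add_2_eq_Suc add_2_eq_Suc')
  qed
qed

text \<open>A binomial identity trades the denominator \<open>m\<close> for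
  \<open>p + m + 2 * i\<close>, as in the final formulas. This includes \<open>m = 0\<close>, where
  \<open>p > 0\<close> keeps the new denominator nonzero.\<close>

lemma power_coeff_eq:
  assumes "p > 0"
  shows "power_coeff p m i = of_nat p / of_nat (p + m + 2 * i) * of_nat ((m + i - 1) choose i)
     * of_nat ((p + 2 * m + 2 * i - 1) choose m)"
proof (cases m)
  case 0
  then show ?thesis using assms by (cases i) (simp_all add: power_coeff_def binomial_eq_0)
next
  case (Suc k)
  define B0 B1 M N :: rat where "B0 = of_nat ((p + 2 * m + 2 * i - 1) choose k)"
    and "B1 = of_nat ((p + 2 * m + 2 * i - 1) choose m)"
    and "M = of_nat m" and "N = of_nat (p + m + 2 * i)"
  have "of_nat (p + 2 * m + 2 * i - 1) - of_nat k = N"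
    using assms Suc by (simp add: N_def of_nat_diff)
  then have "M * B1 = N * B0"
    using of_nat_binomial_step[of k "p + 2 * m + 2 * i - 1"] assms Suc
    by (simp add: B0_def B1_def M_def)
  moreover have "M \<noteq> 0" "N \<noteq> 0" using assms Suc by (simp_all add: M_def N_def)
  ultimately have "B0 / M = B1 / N" by (simp add: frac_eq_eq mult.commute)
  moreover have "power_coeff p m i = of_nat p * of_nat ((m + i - 1) choose i) * (B0 / M)"
    using Suc by (simp add: power_coeff_def B0_def M_def)
  moreover have "of_nat p / of_nat (p + m + 2 * i) * of_nat ((m + i - 1) choose i)
     * of_nat ((p + 2 * m + 2 * i - 1) choose m) = of_nat p * of_nat ((m + i - 1) choose i) * (B1 / N)"
    by (simp add: B1_def N_def)
  ultimately show ?thesis by simp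
qed

section \<open>Words in the modular group\<close>

text \<open>
  The stack \<open>[e\<^sub>l, \<dots>, e\<^sub>0]\<close> stands for the normal form \<open>U\<^bsup>e\<^sub>0\<^esup> S U\<^bsup>e\<^sub>1\<^esup> S \<dots> S U\<^bsup>e\<^sub>l\<^esup>\<close>, on which \<open>rotU\<close> and
  \<open>flipS\<close> act as multiplication by \<open>U\<close> and \<open>S\<close> from the right.
\<close>

fun rotU :: "nat list \<Rightarrow> nat list" where
  "rotU [] = []"
| "rotU (e # es) = (if e = 2 then 0 else Suc e) # es"

text \<open>A 0 on top of another entry means that the normal form ends in S, which then cancels;
  otherwise S is appended and opens a new exponent 0.\<close>

fun flipS :: "nat list \<Rightarrow> nat list" where
  "flipS (0 # e # es) = e # es"
| "flipS es = 0 # es"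

definition stepT :: "nat list \<Rightarrow> nat list" where
  "stepT st = flipS (rotU st)"

text \<open>Truncated subtraction makes \<open>letter 0\<close> equal to \<open>letter 1\<close>;
  the words of interest have positive entries.\<close>

definition letter :: "nat \<Rightarrow> nat list \<Rightarrow> nat list" where
  "letter k st = rotU ((stepT ^^ (k - 1)) st)"

definition run :: "nat list \<Rightarrow> nat list \<Rightarrow> nat list" where
  "run a st = fold letter a st"

text \<open>These are the reduced normal forms: only the first and the last exponent of U may
  vanish.\<close>

definition valid_stack :: "nat list \<Rightarrow> bool" where
  "valid_stack st \<longleftrightarrow> st \<noteq> [] \<and> set st \<subseteq> {..<3} \<and> 0 \<notin> set (butlast (tl st))"

lemma run_simps [simp]:
  "run [] st = st" "run (k # a) st = run a (letter k st)" "run (a @ b) st = run b (run a st)"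
  by (simp_all add: run_def)

lemma valid_stack_Cons: "valid_stack (e # es) \<longleftrightarrow> e < 3 \<and> set es \<subseteq> {..<3} \<and> 0 \<notin> set (butlast es)"
  by (auto simp: valid_stack_def)

lemma valid_stack_rotU: "valid_stack st \<Longrightarrow> valid_stack (rotU st)"
  by (cases st) (auto simp: valid_stack_Cons valid_stack_def[of "[]"])

lemma valid_stack_flipS: "valid_stack st \<Longrightarrow> valid_stack (flipS st)"
  by (cases st rule: flipS.cases) (auto simp: valid_stack_def split: if_splits)

lemma valid_stack_stepT: "valid_stack st \<Longrightarrow> valid_stack (stepT st)"
  by (simp add: stepT_def valid_stack_rotU valid_stack_flipS)

lemma valid_stack_stepT_power: "valid_stack st \<Longrightarrow> valid_stack ((stepT ^^ k) st)"
  by (induction k) (simp_all add: valid_stack_stepT)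

lemma valid_stack_letter: "valid_stack st \<Longrightarrow> valid_stack (letter k st)"
  by (simp add: letter_def valid_stack_rotU valid_stack_stepT_power)

lemma valid_stack_run: "valid_stack st \<Longrightarrow> valid_stack (run a st)"
  by (induction a arbitrary: st) (simp_all add: valid_stack_letter)

lemma flipS_flipS: "valid_stack st \<Longrightarrow> flipS (flipS st) = st"
proof (cases st rule: flipS.cases)
  case (1 e es)
  moreover assume "valid_stack st"
  ultimately show ?thesis by (cases e; cases es) (auto simp: valid_stack_def)
qed (auto simp: valid_stack_def)

lemma rotU_cube: "valid_stack st \<Longrightarrow> rotU (rotU (rotU st)) = st"
  by (cases st) (auto simp: valid_stack_def less_Suc_eq numeral_3_eq_3)

lemma rotU_power_mult_3: "valid_stack st \<Longrightarrow> (rotU ^^ (3 * j)) st = st"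
proof (induction j)
  case (Suc j)
  have "(rotU ^^ (3 * Suc j)) st = (rotU ^^ 3) ((rotU ^^ (3 * j)) st)"
    by (simp add: funpow_add)
  then show ?case using Suc by (simp add: rotU_cube numeral_3_eq_3)
qed simp

lemma letter_1: "letter (Suc 0) = rotU"
  by (simp add: letter_def fun_eq_iff)

lemma letter_Suc: "k > 0 \<Longrightarrow> letter (Suc k) st = letter k (stepT st)"
  by (cases k) (simp_all add: letter_def funpow_swap1)

lemma run_replicate_1: "run (replicate t (Suc 0)) st = (rotU ^^ t) st"
  by (induction t arbitrary: st) (simp_all add: letter_1 funpow_swap1)

text \<open>Since T = US, one has T U^(3j+2) T = U S U^(3j+3) S = U. The pattern removed is the
  trace of a glued cell with 3j+3 vertices.\<close>

lemma run_ear: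
  assumes "valid_stack st" "p > 0" "q > 0"
  shows "run (xs @ [Suc p] @ replicate (3 * j + 1) 1 @ [Suc q] @ ys) st = run (xs @ [p, q] @ ys) st"
proof -
  define g where "g = (stepT ^^ (p - 1)) (run xs st)"
  have g: "valid_stack g" by (simp add: g_def assms(1) valid_stack_stepT_power valid_stack_run)
  have "stepT ((rotU ^^ (3 * j + 1)) (rotU (stepT g)))
      = flipS ((rotU ^^ (3 * Suc j)) (flipS (rotU g)))"
    by (simp add: stepT_def numeral_3_eq_3 funpow_swap1)
  also have "\<dots> = rotU g"
    by (simp only: rotU_power_mult_3[OF valid_stack_flipS[OF valid_stack_rotU[OF g]]] flipS_flipS valid_stack_rotU[OF g])
  finally have "stepT ((rotU ^^ (3 * j + 1)) (rotU (stepT g))) = rotU g" .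
  moreover have "letter (Suc p) (run xs st) = rotU (stepT g)"
    using assms(2) by (cases p) (simp_all add: g_def letter_def)
  ultimately show ?thesis
    using assms(3) by (simp add: run_replicate_1 letter_Suc g_def letter_def[of p] del: replicate_Suc replicate_add funpow.simps)
qed

text \<open>The trace of a cell cut off by one diagonal whose new vertices are consecutive in the
  list, without wrapping around its end.\<close>

definition has_ear :: "nat list \<Rightarrow> bool" where
  "has_ear a \<longleftrightarrow> (\<exists>xs p j q ys. p > 0 \<and> q > 0 \<and>
     a = xs @ [Suc p] @ replicate (3 * j + 1) 1 @ [Suc q] @ ys)"

lemma rotU_power_small: "(rotU ^^ t) (e # es) = ((e + t) mod 3) # es" if "e < 3"
proof (induction t)
  case (Suc t)
  have "(e + t) mod 3 < 3" by simp
  then have "(if (e + t) mod 3 = 2 then 0 else Suc ((e + t) mod 3)) = (e + Suc t) mod 3"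
    by presburger
  then show ?case using Suc by simp
qed (use that in simp)

lemma stepT_0: "stepT (0 # es) = 0 # 1 # es"
  by (cases es) (simp_all add: stepT_def)

text \<open>T can cancel an S only when the top exponent is 2. From a smaller one it leaves 0 on
  top, and so does every further T.\<close>

lemma stepT_power_grow:
  assumes "e < 2" "k > 0"
  shows "\<exists>es'. length es' \<ge> Suc (length es) \<and> (stepT ^^ k) (e # es) = 0 # es'"
  using assms(2)
proof (induction k rule: nat_induct_non_zero)
  case 1
  then show ?case using assms(1) by (cases es) (auto simp: stepT_def)
next
  case (Suc k)
  then obtain es' where "length es' \<ge> Suc (length es)" "(stepT ^^ k) (e # es) = 0 # es'" by blast
  then show ?case by (auto simp: stepT_0)
qed

text \<open>
  In the normal form, \<open>T U\<^sup>t T\<close> ends in \<open>S U\<^bsup>t+1\<^esup> S\<close>, so without ears no \<open>S\<close> ever cancels and the stack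
  keeps growing.
\<close>

lemma run_no_ear:
  assumes "\<forall>x\<in>set a. x > 0" "\<not> has_ear a"
  shows "(\<exists>t. a = replicate t 1) \<or>
    (\<exists>b d t es. a = b @ [Suc d] @ replicate t 1 \<and> d > 0 \<and> es \<noteq> [] \<and> run a [0] = (Suc t mod 3) # es)"
  using assms
\<comment> \<open>The top exponent counts, modulo 3, the U closing the last letter above 1 and one U
  for each 1 after it.\<close>
proof (induction a rule: rev_induct)
  case Nil
  then show ?case by simp
next
  case (snoc c a)
  have ne: "\<not> has_ear a"
  proof
    assume "has_ear a"
    then obtain xs p j q ys where "p > 0" "q > 0" "a = xs @ [Suc p] @ replicate (3 * j + 1) 1 @ [Suc q] @ ys"
      unfolding has_ear_def by blast
    then have "has_ear (a @ [c])"
      unfolding has_ear_def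
      by (intro exI[of _ xs] exI[of _ p] exI[of _ j] exI[of _ q] exI[of _ "ys @ [c]"]) simp
    with snoc.prems show False by simp
  qed
  from snoc.IH[OF _ ne] snoc.prems(1) have IH: "(\<exists>t. a = replicate t 1) \<or>
    (\<exists>b d t es. a = b @ [Suc d] @ replicate t 1 \<and> d > 0 \<and> es \<noteq> [] \<and> run a [0] = (Suc t mod 3) # es)"
    by simp
  show ?case
  proof (cases "c = 1")
    case True
    from IH show ?thesis
    proof (elim disjE exE conjE)
      fix t assume "a = replicate t 1"
      then have "a @ [c] = replicate (Suc t) 1" using True by (simp add: replicate_append_same)
      then show ?thesis by blast
    next
      fix b d t es
      assume *: "a = b @ [Suc d] @ replicate t 1" "d > 0" "es \<noteq> []" "run a [0] = (Suc t mod 3) # es"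
      have "a @ [c] = b @ [Suc d] @ replicate (Suc t) 1"
        using * True by (simp add: replicate_append_same)
      moreover have "run (a @ [c]) [0] = (Suc (Suc t) mod 3) # es"
        using *(4) rotU_power_small[of "Suc t mod 3" 1 es] True by (simp add: letter_1 mod_Suc_eq)
      ultimately show ?thesis using * by blast
    qed
  next
    case False
    then obtain q where q: "c = Suc q" "q > 0" using snoc.prems(1) by (cases c) auto
    \<comment> \<open>Before an entry above 1 is read, the top exponent 2 is possible only on a
      one-element stack.\<close>
    have "\<exists>e es. run a [0] = e # es \<and> e < 3 \<and> (e = 2 \<longrightarrow> es = [])"
    proof -
      from IH show ?thesis
      proof (elim disjE exE conjE)
        fix t assume "a = replicate t 1"
        then show ?thesis using rotU_power_small[of 0 t "[]"] by (simp add: run_replicate_1)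
      next
        fix b d t es
        assume *: "a = b @ [Suc d] @ replicate t 1" "d > 0" "es \<noteq> []" "run a [0] = (Suc t mod 3) # es"
        \<comment> \<open>Otherwise the number of 1's between \<open>Suc d\<close> and
          \<open>c\<close> is 1 modulo 3, which is an ear.\<close>
        have "Suc t mod 3 \<noteq> 2"
        proof
          assume "Suc t mod 3 = 2"
          then have "t mod 3 = 1" by presburger
          then obtain j where "t = 3 * j + 1" by (metis div_mult_mod_eq mult.commute)
          then have "a @ [c] = b @ [Suc d] @ replicate (3 * j + 1) 1 @ [Suc q] @ []"
            using * q by simp
          then have "has_ear (a @ [c])" using q * unfolding has_ear_def by blast
          then show False using snoc.prems by simp
        qed
        then show ?thesis using * by simp
      qed
    qed
    then obtain e es where e: "run a [0] = e # es" "e < 3" "e = 2 \<longrightarrow> es = []" by blast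
    have "\<exists>es'. es' \<noteq> [] \<and> (stepT ^^ q) (e # es) = 0 # es'"
    proof (cases "e = 2")
      case False
      then show ?thesis using stepT_power_grow[of e q es] e q by fastforce
    next
      case True
      \<comment> \<open>With nothing below the top there is no S to cancel, so even the exponent 2
        leads to a push.\<close>
      then have st: "stepT (e # es) = [0, 0]" using e by (simp add: stepT_def)
      obtain q' where q': "q = Suc q'" using q by (cases q) auto
      show ?thesis
      proof (cases q')
        case 0
        then show ?thesis using st q' by auto
      next
        case (Suc q'')
        then show ?thesis using stepT_power_grow[of 0 q' "[0]"] st q'
          by (fastforce simp: funpow_swap1 simp del: funpow.simps(2) simp: funpow_Suc_right)
      qed
    qed
    then obtain es' where es': "es' \<noteq> []" "(stepT ^^ q) (e # es) = 0 # es'" by blast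
    then have "run (a @ [c]) [0] = (Suc 0 mod 3) # es'" using e q by (simp add: letter_def)
    moreover have "a @ [c] = a @ [Suc q] @ replicate 0 1" using q by simp
    ultimately show ?thesis using q es' by blast
  qed
qed

text \<open>Without ears, an entry above 1 leaves at least two stack entries. So only 1's remain,
  and U^t = 1 forces 3 to divide t.\<close>

lemma run_trivial_cases:
  assumes "\<forall>x\<in>set a. x > 0" "run a [0] = [0]"
  shows "has_ear a \<or> (3 dvd length a \<and> a = replicate (length a) 1)"
proof (cases "has_ear a")
  case False
  then obtain t where t: "a = replicate t 1" using run_no_ear[OF assms(1)] assms(2) by auto
  then have "t mod 3 = 0" using assms(2) rotU_power_small[of 0 t "[]"] by (simp add: run_replicate_1)
  then show ?thesis using t by auto
qed simp

section \<open>Counting trivial words\<close>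

text \<open>\<open>b\<close> is the total excess of the entries over 1, that is, the number of
  factors T; \<open>l\<close> counts the factors U that close the letters.\<close>

definition trivial_seqs :: "nat list \<Rightarrow> nat \<Rightarrow> nat \<Rightarrow> nat list set" where
  "trivial_seqs st l b = {a. length a = l \<and> (\<forall>x\<in>set a. x > 0) \<and> sum_list a = l + b \<and> run a st = [0]}"

lemma finite_trivial_seqs: "finite (trivial_seqs st l b)"
proof (rule finite_subset)
  show "trivial_seqs st l b \<subseteq> {a. set a \<subseteq> {..l + b} \<and> length a = l}"
  proof
    fix a assume a: "a \<in> trivial_seqs st l b"
    have "x \<le> l + b" if "x \<in> set a" for x
      using member_le_sum_list[OF that] a by (simp add: trivial_seqs_def)
    then show "a \<in> {a. set a \<subseteq> {..l + b} \<and> length a = l}" using a by (auto simp: trivial_seqs_def)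
  qed
qed (simp add: finite_lists_length_eq)

lemma length_le_sum_list: "\<forall>x\<in>set a. x > 0 \<Longrightarrow> length a \<le> sum_list (a :: nat list)"
  by (induction a) auto

lemma Cons_mem_trivial_seqs:
  "k # a \<in> trivial_seqs st (Suc l) b \<longleftrightarrow> length a = l \<and> k > 0 \<and> (\<forall>x\<in>set a. x > 0) \<and>
     k + sum_list a = Suc (l + b) \<and> run a (letter k st) = [0]"
  by (auto simp: trivial_seqs_def)

lemma trivial_seqs_SucE:
  assumes "a \<in> trivial_seqs st (Suc l) b"
  obtains k a' where "a = Suc k # a'"
  using assms by (cases a; cases "hd a") (auto simp: trivial_seqs_def)

text \<open>Split by the first factor of the product: U if the first entry is 1, otherwise a T,
  which is removed by lowering that entry.\<close>

lemma trivial_seqs_Suc: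
  "trivial_seqs st (Suc l) b = (#) 1 ` trivial_seqs (rotU st) l b \<union>
    (if b = 0 then {} else (\<lambda>a. Suc (hd a) # tl a) ` trivial_seqs (stepT st) (Suc l) (b - 1))" (is "_ = ?R")
proof
  show "trivial_seqs st (Suc l) b \<subseteq> ?R"
  proof
    fix a assume a: "a \<in> trivial_seqs st (Suc l) b"
    then obtain k a' where ka: "a = Suc k # a'" by (rule trivial_seqs_SucE)
    note mem = a[unfolded ka Cons_mem_trivial_seqs]
    show "a \<in> ?R"
    proof (cases k)
      case 0
      then have "a' \<in> trivial_seqs (rotU st) l b" using mem by (simp add: trivial_seqs_def letter_1)
      then show ?thesis using ka 0 by simp
    next
      case (Suc k')
      have "length a' \<le> sum_list a'" using mem by (intro length_le_sum_list) blast
      then have "b > 0" using mem Suc by linarith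
      moreover have "k # a' \<in> trivial_seqs (stepT st) (Suc l) (b - 1)"
        using mem Suc \<open>b > 0\<close> unfolding Cons_mem_trivial_seqs by (simp add: letter_Suc)
      then have "a \<in> (\<lambda>a. Suc (hd a) # tl a) ` trivial_seqs (stepT st) (Suc l) (b - 1)"
        by (rule rev_image_eqI) (simp add: ka)
      ultimately show ?thesis by simp
    qed
  qed
  have "1 # a \<in> trivial_seqs st (Suc l) b" if "a \<in> trivial_seqs (rotU st) l b" for a
    using that unfolding Cons_mem_trivial_seqs by (simp add: trivial_seqs_def letter_1)
  moreover have "Suc (hd a) # tl a \<in> trivial_seqs st (Suc l) b"
    if "a \<in> trivial_seqs (stepT st) (Suc l) (b - 1)" "b \<noteq> 0" for a
  proof -
    from that(1) obtain k a' where ka: "a = Suc k # a'" by (rule trivial_seqs_SucE)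
    show ?thesis using that unfolding ka Cons_mem_trivial_seqs by (simp add: letter_Suc)
  qed
  ultimately show "?R \<subseteq> trivial_seqs st (Suc l) b" by (simp add: image_subset_iff)
qed

lemma card_trivial_seqs_Suc:
  "card (trivial_seqs st (Suc l) b) = card (trivial_seqs (rotU st) l b) +
    (if b = 0 then 0 else card (trivial_seqs (stepT st) (Suc l) (b - 1)))"
proof -
  define g where "g = (\<lambda>a. Suc (hd a) # tl a :: nat list)"
  have inj: "inj_on g (trivial_seqs (stepT st) (Suc l) c)" for c
  proof (rule inj_onI)
    fix x y assume "x \<in> trivial_seqs (stepT st) (Suc l) c" "y \<in> trivial_seqs (stepT st) (Suc l) c" "g x = g y"
    then show "x = y" by (elim trivial_seqs_SucE) (simp add: g_def)
  qed
  have disj: "(#) 1 ` trivial_seqs (rotU st) l b \<inter> g ` trivial_seqs (stepT st) (Suc l) c = {}" for c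
    by (auto simp: g_def elim: trivial_seqs_SucE)
  have "card ((#) (1 :: nat) ` A) = card A" for A
    by (intro card_image) simp
  moreover have "card ((#) 1 ` trivial_seqs (rotU st) l b \<union> g ` trivial_seqs (stepT st) (Suc l) c)
      = card ((#) 1 ` trivial_seqs (rotU st) l b) + card (g ` trivial_seqs (stepT st) (Suc l) c)" for c
    by (intro card_Un_disjoint finite_imageI finite_trivial_seqs disj)
  ultimately show ?thesis
    by (subst trivial_seqs_Suc, fold g_def) (simp add: card_image[OF inj])
qed

lemma card_trivial_seqs_0: "card (trivial_seqs st 0 b) = (if b = 0 \<and> st = [0] then 1 else 0)"
proof -
  have "trivial_seqs st 0 b = (if b = 0 \<and> st = [0] then {[]} else {})" by (auto simp: trivial_seqs_def)
  then show ?thesis by simp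
qed

section \<open>Generating functions of the walks\<close>

definition gf_head :: "rat fps fps \<Rightarrow> nat \<Rightarrow> rat fps fps" where
  "gf_head V e = (if e = 0 then V ^ 2 else if e = 1 then V else 1)"

text \<open>
  \<open>gf V st\<close> enumerates the walks from \<open>st\<close> to \<open>[2]\<close>: a step \<open>U\<close> has weight \<open>z\<close>, a step \<open>T\<close> has weight \<open>w\<close>
  when it raises the stack and \<open>1\<close> when it lowers it.  A last step \<open>U\<close> leads to \<open>[0]\<close>.
\<close>

fun gf :: "rat fps fps \<Rightarrow> nat list \<Rightarrow> rat fps fps" where
  "gf V [] = 0"
| "gf V [e] = gf_head V e * inverse (1 - V ^ 3)"
| "gf V (e # es) = gf_head V e * inverse (1 - fps_X * V ^ 2) * gf V es"

lemma gf_Cons: "gf V (e # es) = gf_head V e * (if es = [] then inverse (1 - V ^ 3)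
    else inverse (1 - fps_X * V ^ 2) * gf V es)"
  by (cases es) (simp_all add: mult.assoc)

text \<open>\<open>V\<close> enumerates the ways to raise the top exponent by one: a step U, or an
  excursion that pushes by T, climbs from 0 to 2, possibly makes full turns there, and pops. The
  vanishing constant term makes \<open>1 - V ^ 3\<close> a unit.\<close>

definition V_equation :: "rat fps fps \<Rightarrow> bool" where
  "V_equation V \<longleftrightarrow> V $ 0 = 0 \<and>
     V = fps_X + fps_const fps_X * (V ^ 2 * inverse (1 - fps_X * V ^ 2))"

lemma V_equation_if_P_equation:
  assumes "P_equation P"
  shows "V_equation (fps_X * P)"
proof -
  define I where "I = inverse (1 - fps_X ^ 3 * P ^ 2)"
  have "fps_X * P = fps_X * P_rhs P"
    by (rule arg_cong[OF assms[unfolded P_equation_iff]])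
  also have "fps_X * P_rhs P = fps_X + fps_const fps_X * ((fps_X * P) ^ 2 * I)"
    unfolding P_rhs_def I_def[symmetric] by (simp add: distrib_left power2_eq_square mult_ac)
  also have "I = inverse (1 - fps_X * (fps_X * P) ^ 2)"
    by (simp add: I_def power2_eq_square power3_eq_cube mult_ac)
  finally have V: "fps_X * P = fps_X + fps_const fps_X * ((fps_X * P) ^ 2 *
      inverse (1 - fps_X * (fps_X * P) ^ 2))" .
  show ?thesis unfolding V_equation_def by (rule conjI, simp, rule V)
qed

context
  fixes V assumes V: "V_equation V"
begin

lemma V_unfold: "V = fps_X + fps_const fps_X * (V ^ 2 * inverse (1 - fps_X * V ^ 2))"
  using V unfolding V_equation_def by blast

text \<open>Split off the first step below exponent 2. Raising the top by one costs a factor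
  \<open>V\<close>, and the equation of \<open>V\<close> is the distinction between U and T.\<close>

lemma gf_push:
  assumes "e < 2"
  shows "gf V (e # es) = fps_X * gf V (Suc e # es) + fps_const fps_X * gf V (0 # Suc e # es)"
proof -
  have "gf V (e # es) = V * gf V (Suc e # es)"
    using assms by (auto simp: gf_Cons gf_head_def less_2_cases_iff power2_eq_square)
  also have "\<dots> = (fps_X + fps_const fps_X * (V ^ 2 * inverse (1 - fps_X * V ^ 2))) * gf V (Suc e # es)"
    by (rule arg_cong2[where f = "(*)", OF V_unfold refl])
  also have "\<dots> = fps_X * gf V (Suc e # es) + fps_const fps_X * gf V (0 # Suc e # es)"
    by (simp add: gf_Cons[of V 0] gf_head_def algebra_simps)
  finally show ?thesis .
qed

text \<open>The geometric series of full turns, unrolled once: U starts another turn, while T pops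
  with weight 1.\<close>

lemma gf_pop: "gf V (2 # e # es) = fps_X * gf V (0 # e # es) + gf V (e # es)"
proof -
  define W where "W = inverse (1 - fps_X * V ^ 2)"
  have "(1 - fps_X * V ^ 2) * W = 1" unfolding W_def by (rule fps_mult_inverse_unit) simp
  then have W: "W = fps_X * V ^ 2 * W + 1" by (simp add: algebra_simps)
  have "gf V (2 # e # es) = W * gf V (e # es)"
    by (simp add: gf_head_def W_def)
  also have "\<dots> = (fps_X * V ^ 2 * W + 1) * gf V (e # es)"
    by (rule arg_cong[OF W])
  also have "\<dots> = fps_X * gf V (0 # e # es) + gf V (e # es)"
    by (simp add: gf_head_def W_def distrib_right mult.assoc)
  finally show ?thesis .
qed

text \<open>At the target the empty walk contributes 1, and T pushes because nothing lies
  below.\<close>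

lemma gf_end: "gf V [2] = 1 + fps_X * gf V [0] + fps_const fps_X * gf V [0, 0]"
proof -
  define G where "G = inverse (1 - V ^ 3)"
  have "(1 - V ^ 3) * G = 1" unfolding G_def
    using V by (intro fps_mult_inverse_unit) (simp add: V_equation_def power3_eq_cube)
  then have G: "G = V * (V ^ 2 * G) + 1"
    by (simp add: algebra_simps power2_eq_square power3_eq_cube)
  have "gf V [2] = G" by (simp add: gf_head_def G_def)
  also note G
  also have "V * (V ^ 2 * G) = (fps_X + fps_const fps_X * (V ^ 2 * inverse (1 - fps_X * V ^ 2))) * (V ^ 2 * G)"
    by (rule arg_cong2[where f = "(*)", OF V_unfold refl])
  also have "\<dots> + 1 = 1 + fps_X * gf V [0] + fps_const fps_X * gf V [0, 0]"
    by (simp add: gf_head_def G_def distrib_right mult.assoc)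
  finally show ?thesis .
qed

declare gf.simps [simp del]

lemma gf_push_nth:
  assumes "e < 2"
  shows "gf V (e # es) $ a $ j = (if a = 0 then 0 else gf V (Suc e # es) $ (a - 1) $ j)
    + (if j = 0 then 0 else gf V (0 # Suc e # es) $ a $ (j - 1))"
  unfolding gf_push[OF assms] by simp

lemma gf_pop_nth:
  "gf V (2 # e # es) $ a $ j
    = (if a = 0 then 0 else gf V (0 # e # es) $ (a - 1) $ j) + gf V (e # es) $ a $ j"
  unfolding gf_pop by simp

lemma gf_end_nth:
  "gf V [2] $ a $ j = (if a = 0 \<and> j = 0 then 1 else 0)
    + (if a = 0 then 0 else gf V [0] $ (a - 1) $ j) + (if j = 0 then 0 else gf V [0, 0] $ a $ (j - 1))"
  unfolding gf_end by (simp add: fps_one_nth)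

text \<open>A walk from height \<open>h\<close> down to height 0 with j raising steps has h + j
  lowering ones, hence h + 2j steps T; w marks only the raising ones.\<close>

definition gf_nth :: "nat list \<Rightarrow> nat \<Rightarrow> nat \<Rightarrow> rat" where
  "gf_nth st a b = (let h = length st - 1 in
     if h \<le> b \<and> even (b - h) then gf V st $ a $ ((b - h) div 2) else 0)"

lemma gf_nth_even: "gf_nth st a (length st - 1 + 2 * j) = gf V st $ a $ j"
  by (simp add: gf_nth_def)

lemma gf_nth_other: "\<nexists>j. b = length st - 1 + 2 * j \<Longrightarrow> gf_nth st a b = 0"
  unfolding gf_nth_def Let_def by (metis evenE le_add_diff_inverse)

text \<open>The first-step recurrence in terms of the number of steps T. A push increases the height
  and uses up one raising step; a pop decreases the height and uses none.\<close>

lemma gf_nth_rec: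
  assumes "valid_stack st"
  shows "gf_nth st a b =
    (if a = 0 then (if b = 0 \<and> rotU st = [0] then 1 else 0) else gf_nth (rotU st) (a - 1) b)
    + (if b = 0 then 0 else gf_nth (stepT st) a (b - 1))"
proof -
  obtain e es where st: "st = e # es" "e < 3" using assms by (cases st) (auto simp: valid_stack_def)
  define h where "h = length es"
  have pushed: "gf_nth (0 # f # es) a (b - 1) =
      (if j = 0 then 0 else gf V (0 # f # es) $ a $ (j - 1))" if "b = h + 2 * j" "b > 0" for f j
  proof (cases j)
    case 0
    with that show ?thesis by (simp add: gf_nth_def h_def Let_def)
  next
    case (Suc i)
    then have "b - 1 = length (0 # f # es) - 1 + 2 * i" using that by (simp add: h_def)
    then show ?thesis using gf_nth_even[of "0 # f # es" a i] Suc by simp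
  qed
  have push0: "gf_nth (0 # f # es) a (b - 1) = 0" if "\<nexists>j. b = h + 2 * j" for f
  proof (rule gf_nth_other, safe)
    fix i assume "b - 1 = length (0 # f # es) - 1 + 2 * i"
    then have "b = h + 2 * Suc i" by (simp add: h_def)
    with that show False by blast
  qed
  have rot: "gf_nth (f # es) a' b = gf V (f # es) $ a' $ j" if "b = h + 2 * j" for f a' j
    using gf_nth_even[of "f # es" a' j] that by (simp add: h_def)
  have rot0: "gf_nth (f # es) a' b = 0" if "\<nexists>j. b = h + 2 * j" for f a'
    using gf_nth_other[of b "f # es" a'] that by (simp add: h_def)
  consider (push) "e < 2" | (ends) "e = 2" "es = []" | (pop) f fs where "e = 2" "es = f # fs"
    using st(2) by (cases es) fastforce+
  then show ?thesis
  proof cases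
    case push
    then have steps: "rotU st = Suc e # es" "stepT st = 0 # Suc e # es"
      by (auto simp: st stepT_def)
    show ?thesis
    proof (cases "\<exists>j. b = h + 2 * j")
      case True
      then obtain j where j: "b = h + 2 * j" by blast
      show ?thesis
        unfolding steps unfolding st
        using rot[OF j, of e a] rot[OF j, of "Suc e" "a - 1"] pushed[OF j, of "Suc e"] j push
        by (auto simp: gf_push_nth[OF push])
    next
      case False
      then show ?thesis unfolding steps unfolding st
        using rot0[OF False, of e a] rot0[OF False, of "Suc e" "a - 1"] push0[OF False, of "Suc e"] push
        by auto
    qed
  next
    case ends
    then have steps: "rotU st = [0]" "stepT st = [0, 0]" by (auto simp: st stepT_def)
    have h0: "h = 0" using ends by (simp add: h_def)
    show ?thesis
    proof (cases "\<exists>j. b = h + 2 * j")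
      case True
      then obtain j where j: "b = h + 2 * j" by blast
      show ?thesis
        unfolding steps unfolding st
        using rot[OF j, of 2 a] rot[OF j, of 0 "a - 1"] pushed[OF j, of 0] j ends h0
        by (auto simp: gf_end_nth)
    next
      case False
      then have "b \<noteq> 0" using h0 by fastforce
      then show ?thesis unfolding steps unfolding st
        using rot0[OF False, of e a] rot0[OF False, of 0 "a - 1"] push0[OF False, of 0] ends
        by auto
    qed
  next
    case pop
    then have steps: "rotU st = 0 # es" "stepT st = es" by (auto simp: st stepT_def)
    show ?thesis
    proof (cases "\<exists>j. b = h + 2 * j")
      case True
      then obtain j where j: "b = h + 2 * j" by blast
      then have b: "b > 0" "b - 1 = length es - 1 + 2 * j" using pop by (simp_all add: h_def)
      have "gf_nth es a (b - 1) = gf V es $ a $ j" unfolding b(2) by (rule gf_nth_even)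
      then show ?thesis
        unfolding steps unfolding st
        using rot[OF j, of 2 a] rot[OF j, of 0 "a - 1"] b pop by (auto simp: gf_pop_nth)
    next
      case False
      have "gf_nth es a (b - 1) = 0" if "b > 0"
      proof (rule gf_nth_other, safe)
        fix i assume "b - 1 = length es - 1 + 2 * i"
        then have "b = h + 2 * i" using that pop by (simp add: h_def)
        with False show False by blast
      qed
      then show ?thesis unfolding steps unfolding st
        using rot0[OF False, of e a] rot0[OF False, of 0 "a - 1"] False pop
        by (auto simp: h_def)
    qed
  qed
qed

text \<open>Counts and coefficients obey the same recurrence, in which U lowers \<open>a\<close> and
  T lowers \<open>b\<close>. The last U, from \<open>[2]\<close> to \<open>[0]\<close>, is not
  weighted, hence \<open>Suc a\<close>.\<close>

lemma card_trivial_seqs_eq_gf_nth: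
  assumes "valid_stack st"
  shows "of_nat (card (trivial_seqs st (Suc a) b)) = gf_nth st a b"
  using assms
proof (induction "a + b" arbitrary: st a b rule: less_induct)
  case less
  have "of_nat (card (trivial_seqs (rotU st) a b)) =
     (if a = 0 then (if b = 0 \<and> rotU st = [0] then 1 else 0) else gf_nth (rotU st) (a - 1) b)"
    using less.hyps[of "a - 1" b "rotU st"] valid_stack_rotU[OF less.prems]
    by (cases a) (simp_all add: card_trivial_seqs_0)
  moreover have "of_nat (if b = 0 then 0 else card (trivial_seqs (stepT st) (Suc a) (b - 1))) =
     (if b = 0 then 0 else gf_nth (stepT st) a (b - 1))"
    using less.hyps[of a "b - 1" "stepT st"] valid_stack_stepT[OF less.prems] by simp
  ultimately show ?case
    by (subst card_trivial_seqs_Suc, subst gf_nth_rec[OF less.prems]) (simp only: of_nat_add)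
qed

end

lemma card_trivial_seqs_eq_gf:
  assumes "V_equation V"
  shows "of_nat (card (trivial_seqs [0] (Suc a) (2 * j))) = gf V [0] $ a $ j"
  using card_trivial_seqs_eq_gf_nth[OF assms, of "[0]" a "2 * j"] gf_nth_even[OF assms, of "[0]" a j]
  by (simp add: valid_stack_def)

text \<open>Expand V^2 / (1 - V^3) into the powers V^(3i+2) and substitute V = zP.\<close>

lemma gf_0_nth:
  assumes "P_equation P"
  shows "gf (fps_X * P) [0] $ Suc n $ j
    = (\<Sum>i | 3 * i < n. power_nth (3 * i + 2) (n - 1 - 3 * i) j)"
proof -
  define V where "V = fps_X * P"
  define B where "B = gf V [0]"
  have "(1 - V ^ 3) * inverse (1 - V ^ 3) = 1"
    by (intro fps_mult_inverse_unit) (simp add: V_def power3_eq_cube)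
  then have "V ^ 2 * ((1 - V ^ 3) * inverse (1 - V ^ 3)) = V ^ 2" by simp
  then have "(1 - V ^ 3) * B = V ^ 2"
    by (simp add: B_def gf.simps gf_head_def mult_ac)
  then have B: "B = V ^ 2 + V ^ 3 * B" by (simp add: algebra_simps)
  have step: "V ^ (3 * k) * B = V ^ (3 * k + 2) + V ^ (3 * Suc k) * B" for k
  proof -
    have "V ^ (3 * k) * B = V ^ (3 * k) * (V ^ 2 + V ^ 3 * B)"
      by (rule arg_cong[OF B])
    also have "\<dots> = V ^ (3 * k + 2) + V ^ (3 * Suc k) * B"
      by (simp add: power_add distrib_left mult_ac power2_eq_square)
    finally show ?thesis .
  qed
  have "B = (\<Sum>i<k. V ^ (3 * i + 2)) + V ^ (3 * k) * B" for k
  proof (induction k)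
    case (Suc k)
    note Suc
    also note step[of k]
    also have "(\<Sum>i<k. V ^ (3 * i + 2)) + (V ^ (3 * k + 2) + V ^ (3 * Suc k) * B)
        = (\<Sum>i<Suc k. V ^ (3 * i + 2)) + V ^ (3 * Suc k) * B"
      by (simp only: sum.lessThan_Suc add.assoc)
    finally show ?case .
  qed simp
  \<comment> \<open>The remainder is divisible by z^(3n+3), so \<open>Suc n\<close> terms determine
    the coefficient at \<open>Suc n\<close>.\<close>
  note this[of "Suc n"]
  also have "(\<Sum>i<Suc n. V ^ (3 * i + 2)) = (\<Sum>i<Suc n. fps_X ^ (3 * i + 2) * P ^ (3 * i + 2))"
    by (simp only: V_def power_mult_distrib)
  also have "V ^ (3 * Suc n) * B = fps_X ^ (3 * Suc n) * (P ^ (3 * Suc n) * B)"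
    by (simp only: V_def power_mult_distrib mult.assoc)
  finally have eq: "B = (\<Sum>i<Suc n. fps_X ^ (3 * i + 2) * P ^ (3 * i + 2))
      + fps_X ^ (3 * Suc n) * (P ^ (3 * Suc n) * B)" .
  have "B $ Suc n $ j = (\<Sum>i<Suc n. (fps_X ^ (3 * i + 2) * P ^ (3 * i + 2)) $ Suc n $ j)
     + (fps_X ^ (3 * Suc n) * (P ^ (3 * Suc n) * B)) $ Suc n $ j"
    by (subst eq) (simp only: fps_add_nth fps_sum_nth)
  also have "(fps_X ^ (3 * Suc n) * (P ^ (3 * Suc n) * B)) $ Suc n = 0"
    unfolding fps_X_power_mult_nth by simp
  also have "(\<Sum>i<Suc n. (fps_X ^ (3 * i + 2) * P ^ (3 * i + 2)) $ Suc n $ j)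
    = (\<Sum>i<Suc n. if 3 * i < n then power_nth (3 * i + 2) (n - 1 - 3 * i) j else 0)"
  proof (rule sum.cong[OF refl])
    fix i
    have "Suc n - (3 * i + 2) = n - 1 - 3 * i" by simp
    then show "(fps_X ^ (3 * i + 2) * P ^ (3 * i + 2)) $ Suc n $ j
        = (if 3 * i < n then power_nth (3 * i + 2) (n - 1 - 3 * i) j else 0)"
      unfolding fps_X_power_mult_nth P_power_nth[OF assms, symmetric] by auto
  qed
  also have "\<dots> = (\<Sum>i | i < Suc n \<and> 3 * i < n. power_nth (3 * i + 2) (n - 1 - 3 * i) j)"
    by (subst sum.inter_filter[symmetric]) (simp_all add: lessThan_def)
  also have "{i. i < Suc n \<and> 3 * i < n} = {i. 3 * i < n}" by auto
  finally show ?thesis by (simp add: B_def V_def)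
qed

section \<open>Ears of dissections\<close>

text \<open>Arbitrary vertex sets are allowed because removing an ear leaves labels with
  gaps.\<close>

definition cells_of :: "nat set \<Rightarrow> chord set \<Rightarrow> nat set set" where
  "cells_of V D = {C. C \<subseteq> V \<and> 3 \<le> card C \<and> sides C \<subseteq> sides V \<union> D \<and> diagonals C \<inter> D = {}}"

definition dissects :: "nat set \<Rightarrow> chord set \<Rightarrow> bool" where
  "dissects V D \<longleftrightarrow> D \<subseteq> diagonals V \<and> (\<forall>c\<in>D. \<forall>d\<in>D. \<not> crossing c d)"

definition degree :: "nat set \<Rightarrow> chord set \<Rightarrow> nat \<Rightarrow> nat" where
  "degree V D v = card {C \<in> cells_of V D. v \<in> C}"

definition quiddity_of :: "nat set \<Rightarrow> chord set \<Rightarrow> nat list" where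
  "quiddity_of V D = map (degree V D) (sorted_list_of_set V)"

section \<open>Sides, diagonals and neighbouring vertices\<close>

lemma mem_chords: "(i, j) \<in> chords V \<longleftrightarrow> i \<in> V \<and> j \<in> V \<and> i < j"
  by (simp add: chords_def)

lemma mem_sides:
  "(i, j) \<in> sides V \<longleftrightarrow> i \<in> V \<and> j \<in> V \<and> i < j \<and> (V \<inter> {i<..<j} = {} \<or> V \<subseteq> {i..j})"
  by (simp add: sides_def mem_chords)

lemma mem_diagonals:
  "(i, j) \<in> diagonals V \<longleftrightarrow> i \<in> V \<and> j \<in> V \<and> i < j \<and> V \<inter> {i<..<j} \<noteq> {} \<and> \<not> V \<subseteq> {i..j}"
  by (auto simp: diagonals_def mem_chords mem_sides)

lemma finite_cells_of: "finite V \<Longrightarrow> finite (cells_of V D)"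
  by (rule finite_subset[of _ "Pow V"]) (auto simp: cells_of_def)

lemma inside_nonempty:
  fixes C :: "nat set"
  assumes "C \<subseteq> {i..j}" "3 \<le> card C"
  shows "C \<inter> {i<..<j} \<noteq> {}"
proof
  assume "C \<inter> {i<..<j} = {}"
  with assms(1) have "C \<subseteq> {i, j}" by force
  then have "card C \<le> card {i, j}" by (intro card_mono) auto
  also have "\<dots> \<le> 2" by (simp add: card_insert_if)
  finally show False using assms(2) by simp
qed

lemma Min_Max_side:
  assumes "3 \<le> card C"
  shows "(Min C, Max C) \<in> sides C" "C \<inter> {Min C<..<Max C} \<noteq> {}"
proof -
  have fin: "finite C" and ne: "C \<noteq> {}" using assms by (auto intro: card_ge_0_finite)
  have sub: "C \<subseteq> {Min C..Max C}" using fin by auto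
  show *: "C \<inter> {Min C<..<Max C} \<noteq> {}" using inside_nonempty[OF sub assms] .
  show "(Min C, Max C) \<in> sides C"
    using fin ne sub * by (auto simp: mem_sides)
qed

lemma next_vertex:
  fixes C :: "nat set"
  assumes "finite C" "c \<in> C" "b < c"
  obtains y where "y \<in> C" "b < y" "C \<inter> {b<..<y} = {}"
proof
  let ?Y = "{y \<in> C. b < y}"
  have Y: "finite ?Y" "?Y \<noteq> {}" using assms by auto
  show "Min ?Y \<in> C" "b < Min ?Y" using Min_in[OF Y] by auto
  have "\<not> c < Min ?Y" if "c \<in> C" "b < c" for c
    by (rule leD, rule Min_le[OF Y(1)]) (use that in simp)
  then show "C \<inter> {b<..<Min ?Y} = {}" by fastforce
qed

lemma previous_vertex:
  fixes C :: "nat set"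
  assumes "finite C" "c \<in> C" "c < b"
  obtains y where "y \<in> C" "y < b" "C \<inter> {y<..<b} = {}"
proof
  let ?Y = "{y \<in> C. y < b}"
  have Y: "finite ?Y" "?Y \<noteq> {}" using assms by auto
  show "Max ?Y \<in> C" "Max ?Y < b" using Max_in[OF Y] by auto
  have "\<not> Max ?Y < c" if "c \<in> C" "c < b" for c
    by (rule leD, rule Max_ge[OF Y(1)]) (use that in simp)
  then show "C \<inter> {Max ?Y<..<b} = {}" by fastforce
qed

text \<open>If a cell missed a vertex x, its side facing x would be a side of \<open>V\<close>,
  although it separates x from a third vertex of the cell.\<close>

lemma cells_of_empty:
  assumes "3 \<le> card V"
  shows "cells_of V {} = {V}"
proof -
  have "C = V" if C: "C \<in> cells_of V {}" for C
  proof (rule ccontr)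
    assume "C \<noteq> V"
    with C obtain x where x: "x \<in> V" "x \<notin> C" by (auto simp: cells_of_def)
    have c3: "3 \<le> card C" and sub: "sides C \<subseteq> sides V" "C \<subseteq> V" using C by (auto simp: cells_of_def)
    then have fin: "finite C" and ne: "C \<noteq> {}" by (auto intro: card_ge_0_finite)
    show False
    proof (cases "Min C < x \<and> x < Max C")
      case True
      obtain k where k: "k \<in> C" "k < x" "C \<inter> {k<..<x} = {}"
        using previous_vertex[OF fin, of "Min C" x] True fin ne by auto
      obtain l where l: "l \<in> C" "x < l" "C \<inter> {x<..<l} = {}"
        using next_vertex[OF fin, of "Max C" x] True fin ne by auto
      have e: "C \<inter> {k<..<l} = {}"
      proof -
        have "{k<..<l} \<subseteq> {k<..<x} \<union> {x} \<union> {x<..<l}" by auto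
        then show ?thesis using k l x by blast
      qed
      with k l have "(k, l) \<in> sides C" by (auto simp: mem_sides)
      then have "(k, l) \<in> sides V" using sub by blast
      moreover have "x \<in> V \<inter> {k<..<l}" using x k l by simp
      ultimately have "C \<subseteq> {k..l}" using sub by (auto simp: mem_sides)
      with e inside_nonempty[OF _ c3] show False by blast
    next
      case False
      moreover have "Min C \<noteq> x" "Max C \<noteq> x" using x fin ne Min_in Max_in by blast+
      ultimately have "\<not> V \<subseteq> {Min C..Max C}" using x by auto
      moreover have "(Min C, Max C) \<in> sides V" using Min_Max_side[OF c3] sub by blast
      ultimately show False using Min_Max_side(2)[OF c3] sub by (auto simp: mem_sides)
    qed
  qed
  moreover have "V \<in> cells_of V {}" using assms by (simp add: cells_of_def)
  ultimately show ?thesis by blast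
qed

text \<open>The polygon \<open>V\<close> arises from \<open>W\<close> by gluing a cell with the new vertices \<open>B\<close> to the side \<open>(i, j)\<close>.\<close>

context
  fixes V W B :: "nat set" and D :: "chord set" and i j :: nat
  assumes W: "finite W" "3 \<le> card W" "i \<in> W" "j \<in> W" "i < j" "W \<inter> {i<..<j} = {}"
    and B: "finite B" "B \<noteq> {}" "B \<subseteq> {i<..<j}"
    and V: "V = W \<union> B"
    and D: "D \<subseteq> chords W" "(i, j) \<notin> D"
begin

lemma ear_outside: "\<not> W \<subseteq> {i..j}"
  using inside_nonempty[of W i j] W by blast

text \<open>Chords in \<open>D\<close> end in \<open>W\<close>, which meets the new cell only in
  \<open>i\<close> and \<open>j\<close>, so none of them cuts it.\<close>

lemma ear_mem: "{i, j} \<union> B \<in> cells_of V (insert (i, j) D)"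
proof -
  obtain b where b: "b \<in> B" using B by blast
  then have "card {i, b, j} \<le> card ({i, j} \<union> B)" using B by (intro card_mono) auto
  moreover have "card {i, b, j} = 3" using b B by auto
  moreover have "(x, y) \<in> sides V \<union> insert (i, j) D" if "(x, y) \<in> sides ({i, j} \<union> B)" for x y
  proof (cases "(x, y) = (i, j)")
    case False
    from that have xy: "x \<in> {i, j} \<union> B" "y \<in> {i, j} \<union> B" "x < y" by (auto simp: mem_sides)
    then have r: "i \<le> x" "y \<le> j" using B W by auto
    with False have "\<not> {i, j} \<union> B \<subseteq> {x..y}" by auto
    with that have "({i, j} \<union> B) \<inter> {x<..<y} = {}" unfolding mem_sides by blast
    moreover have "W \<inter> {x<..<y} = {}" using W r by fastforce
    ultimately have "V \<inter> {x<..<y} = {}" using V by blast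
    then show ?thesis using xy V W by (auto simp: mem_sides)
  qed simp
  moreover have "(x, y) \<notin> insert (i, j) D" if "(x, y) \<in> diagonals ({i, j} \<union> B)" for x y
  proof
    assume "(x, y) \<in> insert (i, j) D"
    with D W have "x \<in> W" "y \<in> W" by (auto simp: mem_chords)
    with that W B have "x \<in> {i, j}" "y \<in> {i, j}" "x < y" by (auto simp: mem_diagonals)
    then have "x = i" "y = j" using W by auto
    with that B W show False by (fastforce simp: mem_diagonals)
  qed
  ultimately show ?thesis using V W by (auto simp: cells_of_def)
qed

lemma cells_of_subset: "cells_of W D \<subseteq> cells_of V (insert (i, j) D)"
proof
  fix C assume C: "C \<in> cells_of W D"
  have "(x, y) \<in> sides V \<union> insert (i, j) D" if "(x, y) \<in> sides C" for x y
  proof -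
    have "(x, y) \<in> sides W \<union> D" using that C by (auto simp: cells_of_def)
    moreover have ?thesis if s: "(x, y) \<in> sides W" "(x, y) \<noteq> (i, j)"
    proof (cases "W \<subseteq> {x..y}")
      case True
      then have "B \<subseteq> {x..y}" using W B by fastforce
      with s True V show ?thesis by (auto simp: mem_sides)
    next
      case False
      with s have xy: "x \<in> W" "y \<in> W" "x < y" "W \<inter> {x<..<y} = {}" by (auto simp: mem_sides)
      \<comment> \<open>Between two neighbours x < y of \<open>W\<close>, the vertex b would lie in
        the same gap of \<open>W\<close> as between \<open>i\<close> and \<open>j\<close>, forcing
        (x, y) = (i, j).\<close>
      have "b \<notin> {x<..<y}" if "b \<in> B" for b
      proof
        assume "b \<in> {x<..<y}"
        moreover have "i < b" "b < j" using that B by auto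
        moreover have "\<not> (i < x \<and> x < j)" "\<not> (i < y \<and> y < j)"
          "\<not> (x < i \<and> i < y)" "\<not> (x < j \<and> j < y)" using xy W by auto
        ultimately have "x = i \<and> y = j" by auto
        with s show False by simp
      qed
      with xy V show ?thesis by (auto simp: mem_sides)
    qed
    ultimately show ?thesis by blast
  qed
  moreover have "(i, j) \<notin> diagonals C" using C W by (auto simp: mem_diagonals cells_of_def)
  ultimately show "C \<in> cells_of V (insert (i, j) D)"
    using C V by (auto simp: cells_of_def)
qed

text \<open>
  A vertex of \<open>B\<close> has no chord, so a cell containing it also contains its two neighbours in \<open>V\<close>.
\<close>

lemma cell_successor:
  assumes C: "C \<in> cells_of V (insert (i, j) D)" and b: "b \<in> C" "b \<in> B"
  shows "\<exists>y\<in>C. b < y \<and> V \<inter> {b<..<y} = {}"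
proof -
  have c3: "3 \<le> card C" and "C \<subseteq> V" using C by (auto simp: cells_of_def)
  then have fin: "finite C" by (intro card_ge_0_finite) simp
  have bij: "i < b" "b < j" "b \<notin> W" using b B W by auto
  show ?thesis
  proof (cases "\<exists>c\<in>C. b < c")
    case True
    then obtain y where y: "y \<in> C" "b < y" "C \<inter> {b<..<y} = {}"
      using next_vertex[OF fin] by blast
    then have "(b, y) \<in> sides C" using b by (simp add: mem_sides)
    then have "(b, y) \<in> sides V" using C bij D by (auto simp: cells_of_def mem_chords)
    moreover have "\<not> V \<subseteq> {b..y}" using V W bij by fastforce
    ultimately show ?thesis using y by (auto simp: mem_sides)
  next
    case False
    \<comment> \<open>The closing side from \<open>Min C\<close> to b would have to be a side of
      \<open>V\<close>, but \<open>V\<close> has vertices between its ends as well as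
      \<open>j\<close> beyond it.\<close>
    then have "Max C = b" using b fin by (intro Max_eqI) auto
    then have "(Min C, b) \<in> sides C" "C \<inter> {Min C<..<b} \<noteq> {}" using Min_Max_side[OF c3] by auto
    moreover from this have "(Min C, b) \<in> sides V" using C bij D by (auto simp: cells_of_def mem_chords)
    moreover have "\<not> V \<subseteq> {Min C..b}" using V W bij by fastforce
    ultimately have False using \<open>C \<subseteq> V\<close> by (auto simp: mem_sides)
    then show ?thesis ..
  qed
qed

lemma cell_predecessor:
  assumes C: "C \<in> cells_of V (insert (i, j) D)" and b: "b \<in> C" "b \<in> B"
  shows "\<exists>y\<in>C. y < b \<and> V \<inter> {y<..<b} = {}"
proof -
  have c3: "3 \<le> card C" and "C \<subseteq> V" using C by (auto simp: cells_of_def)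
  then have fin: "finite C" by (intro card_ge_0_finite) simp
  have bij: "i < b" "b < j" "b \<notin> W" using b B W by auto
  show ?thesis
  proof (cases "\<exists>c\<in>C. c < b")
    case True
    then obtain y where y: "y \<in> C" "y < b" "C \<inter> {y<..<b} = {}"
      using previous_vertex[OF fin] by blast
    then have "(y, b) \<in> sides C" using b by (simp add: mem_sides)
    then have "(y, b) \<in> sides V" using C bij D by (auto simp: cells_of_def mem_chords)
    moreover have "\<not> V \<subseteq> {y..b}" using V W bij by fastforce
    ultimately show ?thesis using y by (auto simp: mem_sides)
  next
    case False
    then have "Min C = b" using b fin by (intro Min_eqI) auto
    then have "(b, Max C) \<in> sides C" "C \<inter> {b<..<Max C} \<noteq> {}" using Min_Max_side[OF c3] by auto
    moreover from this have "(b, Max C) \<in> sides V" using C bij D by (auto simp: cells_of_def mem_chords)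
    moreover have "\<not> V \<subseteq> {b..Max C}" using V W bij by fastforce
    ultimately have False using \<open>C \<subseteq> V\<close> by (auto simp: mem_sides)
    then show ?thesis ..
  qed
qed

text \<open>Passing from neighbour to neighbour, the cell picks up everything from \<open>i\<close>
  to \<open>j\<close>. A further vertex would make (i, j) one of its diagonals.\<close>

lemma cell_eq_ear:
  assumes C: "C \<in> cells_of V (insert (i, j) D)" and b: "b \<in> C" "b \<in> B"
  shows "C = {i, j} \<union> B"
proof -
  have "C \<subseteq> V" and "3 \<le> card C" using C by (auto simp: cells_of_def)
  then have fin: "finite C" by (intro card_ge_0_finite) simp
  have bij: "i < b" "b < j" using b B by auto
  have mid: "u \<in> B" if "u \<in> C" "i < u" "u < j" for u
    using that \<open>C \<subseteq> V\<close> V W by auto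
  have "v \<in> C" if v: "v \<in> {i, j} \<union> B" for v
  proof (rule ccontr)
    assume vC: "v \<notin> C"
    have vV: "v \<in> V" "i \<le> v" "v \<le> j" using v V W B by auto
    consider "b < v" | "v < b" using vC b by (metis nat_neq_iff)
    then show False
    proof cases
      case 1
      \<comment> \<open>The vertex of the cell nearest to the missing v, on the side of b, lies in
        \<open>B\<close>; its neighbour in \<open>V\<close> towards v must then belong to the cell
        too.\<close>
      then obtain u where u: "u \<in> C" "u < v" "C \<inter> {u<..<v} = {}"
        using previous_vertex[OF fin b(1)] by blast
      then have "b \<le> u" using b 1 by force
      then have "u \<in> B" using mid[OF u(1)] u bij vV by simp
      then obtain y where "y \<in> C" "u < y" "V \<inter> {u<..<y} = {}"
        using cell_successor[OF C u(1)] by blast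
      then show False using u vV vC by (metis IntI disjoint_iff greaterThanLessThan_iff linorder_neqE_nat)
    next
      case 2
      then obtain u where u: "u \<in> C" "v < u" "C \<inter> {v<..<u} = {}"
        using next_vertex[OF fin b(1)] by blast
      then have "u \<le> b" using b 2 by force
      then have "u \<in> B" using mid[OF u(1)] u bij vV by simp
      then obtain y where "y \<in> C" "y < u" "V \<inter> {y<..<u} = {}"
        using cell_predecessor[OF C u(1)] by blast
      then show False using u vV vC by (metis IntI disjoint_iff greaterThanLessThan_iff linorder_neqE_nat)
    qed
  qed
  then have sub: "{i, j} \<union> B \<subseteq> C" by blast
  have "C \<subseteq> {i..j}"
  proof (rule ccontr)
    assume "\<not> C \<subseteq> {i..j}"
    then have "(i, j) \<in> diagonals C" using sub b bij W by (auto simp: mem_diagonals)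
    then show False using C by (auto simp: cells_of_def)
  qed
  then have "C \<subseteq> {i, j} \<union> B" using mid by force
  with sub show ?thesis by blast
qed

text \<open>A cell meeting \<open>B\<close> is the ear. For a cell avoiding \<open>B\<close>, sides
  of \<open>V\<close> with ends in \<open>W\<close> are sides of \<open>W\<close>, and so is (i,
  j).\<close>

lemma cells_of_insert_ear:
  "cells_of V (insert (i, j) D) = insert ({i, j} \<union> B) (cells_of W D)"
proof -
  have "C \<in> cells_of W D" if C: "C \<in> cells_of V (insert (i, j) D)" and "C \<inter> B = {}" for C
  proof -
    have CW: "C \<subseteq> W" using that V by (auto simp: cells_of_def)
    have "(x, y) \<in> sides W \<union> D" if "(x, y) \<in> sides C" for x y
    proof -
      have "(x, y) \<in> sides V \<union> insert (i, j) D" using that C by (auto simp: cells_of_def)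
      moreover have "x \<in> W" "y \<in> W" using that CW by (auto simp: mem_sides)
      ultimately show ?thesis using V W by (auto simp: mem_sides)
    qed
    then show ?thesis using C CW by (auto simp: cells_of_def)
  qed
  then show ?thesis using ear_mem cells_of_subset cell_eq_ear by blast
qed

lemma ear_not_mem: "{i, j} \<union> B \<notin> cells_of W D"
  using B W by (auto simp: cells_of_def)

lemma card_cells_of_insert_ear: "card (cells_of V (insert (i, j) D)) = Suc (card (cells_of W D))"
  unfolding cells_of_insert_ear using ear_not_mem finite_cells_of[OF W(1)] by simp

lemma degree_insert_ear:
  "degree V (insert (i, j) D) v = (if v \<in> {i, j} \<union> B then Suc (degree W D v) else degree W D v)"
proof -
  have "{C \<in> cells_of V (insert (i, j) D). v \<in> C}
    = (if v \<in> {i, j} \<union> B then insert ({i, j} \<union> B) {C \<in> cells_of W D. v \<in> C} else {C \<in> cells_of W D. v \<in> C})"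
    unfolding cells_of_insert_ear by auto
  then show ?thesis
    unfolding degree_def using ear_not_mem finite_cells_of[OF W(1)] by simp
qed

lemma degree_outside: "v \<in> B \<Longrightarrow> degree W D v = 0"
  using B W unfolding degree_def by (subst card_eq_0_iff) (auto simp: cells_of_def)

text \<open>No vertex of \<open>W\<close> lies strictly between \<open>i\<close> and
  \<open>j\<close>, so no chord of \<open>W\<close> crosses (i, j).\<close>

lemma dissects_insert_ear: "dissects V (insert (i, j) D) \<longleftrightarrow> dissects W D"
proof -
  have noncr: "\<not> crossing (i, j) d" "\<not> crossing d (i, j)" if "d \<in> D" for d
    using that D W by (cases d; force simp: mem_chords)+
  have "(i, j) \<in> diagonals V"
    using W B V ear_outside by (auto simp: mem_diagonals)
  moreover have "(x, y) \<in> diagonals V \<longleftrightarrow> (x, y) \<in> diagonals W" if "(x, y) \<in> D" for x y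
  proof -
    have xy: "x \<in> W" "y \<in> W" "x < y" "(x, y) \<noteq> (i, j)" using that D by (auto simp: mem_chords)
    have "V \<subseteq> {x..y} \<longleftrightarrow> W \<subseteq> {x..y}"
      using V W B by fastforce
    moreover have "V \<inter> {x<..<y} = {} \<longleftrightarrow> W \<inter> {x<..<y} = {}"
    proof
      assume e: "W \<inter> {x<..<y} = {}"
      have "b \<notin> {x<..<y}" if "b \<in> B" for b
      proof
        assume "b \<in> {x<..<y}"
        moreover have "i < b" "b < j" using that B by auto
        moreover have "\<not> (i < x \<and> x < j)" "\<not> (i < y \<and> y < j)"
          "\<not> (x < i \<and> i < y)" "\<not> (x < j \<and> j < y)" using xy W e by auto
        ultimately have "x = i \<and> y = j" by auto
        with xy show False by simp
      qed
      with e V show "V \<inter> {x<..<y} = {}" by blast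
    qed (use V in blast)
    ultimately show ?thesis using xy V by (auto simp: mem_diagonals)
  qed
  then have "D \<subseteq> diagonals V \<longleftrightarrow> D \<subseteq> diagonals W" by auto
  ultimately show ?thesis using noncr by (auto simp: dissects_def)
qed

end

section \<open>Ears in lists: from dissections to words and back\<close>

lemma sorted_list_of_set_eqI:
  "sorted_wrt (<) xs \<Longrightarrow> sorted_list_of_set (set xs) = (xs :: nat list)"
  using sorted_list_of_set.idem_if_sorted_distinct strict_sorted_iff by blast

text \<open>Gluing in list form, producing the pattern of \<open>has_ear\<close>. Nonemptiness of
  \<open>us\<close> or \<open>vs\<close> provides the third vertex of \<open>W\<close>.\<close>

lemma quiddity_of_insert_ear:
  fixes us bs vs :: "nat list" and i j :: nat
  defines "V \<equiv> set (us @ [i] @ bs @ [j] @ vs)" and "W \<equiv> set (us @ [i, j] @ vs)"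
  assumes sorted: "sorted_wrt (<) (us @ [i] @ bs @ [j] @ vs)"
    and ne: "bs \<noteq> []" "us \<noteq> [] \<or> vs \<noteq> []"
    and D: "D \<subseteq> chords W" "(i, j) \<notin> D"
  shows "quiddity_of W D = map (degree W D) us @ [degree W D i, degree W D j] @ map (degree W D) vs"
    and "quiddity_of V (insert (i, j) D) = map (degree W D) us @ [Suc (degree W D i)] @
      replicate (length bs) 1 @ [Suc (degree W D j)] @ map (degree W D) vs"
    and "cells_of V (insert (i, j) D) = insert ({i, j} \<union> set bs) (cells_of W D)"
    and "card (cells_of V (insert (i, j) D)) = Suc (card (cells_of W D))"
    and "dissects V (insert (i, j) D) \<longleftrightarrow> dissects W D"
    and "card ({i, j} \<union> set bs) = length bs + 2"
    and "card W = length us + length vs + 2"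
proof -
  have sW: "sorted_wrt (<) (us @ [i, j] @ vs)"
    using sorted by (auto simp: sorted_wrt_append)
  have dist: "distinct (us @ [i] @ bs @ [j] @ vs)" using sorted strict_sorted_iff by blast
  show cW: "card W = length us + length vs + 2"
    unfolding W_def using dist by (subst distinct_card) auto
  have "card (set ([i, j] @ bs)) = length ([i, j] @ bs)"
    using dist by (intro distinct_card) auto
  then show "card ({i, j} \<union> set bs) = length bs + 2" by simp
  have W: "finite W" "3 \<le> card W" "i \<in> W" "j \<in> W" "i < j" "W \<inter> {i<..<j} = {}"
    using sorted ne(2) unfolding cW
    by (auto simp: W_def sorted_wrt_append neq_Nil_conv)
  have B: "finite (set bs)" "set bs \<noteq> {}" "set bs \<subseteq> {i<..<j}"
    using sorted ne(1) by (auto simp: sorted_wrt_append)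
  have V: "V = W \<union> set bs" by (auto simp: V_def W_def)
  note ear = W B V D
  show "cells_of V (insert (i, j) D) = insert ({i, j} \<union> set bs) (cells_of W D)"
    by (rule cells_of_insert_ear[OF ear])
  show "card (cells_of V (insert (i, j) D)) = Suc (card (cells_of W D))"
    by (rule card_cells_of_insert_ear[OF ear])
  show "dissects V (insert (i, j) D) \<longleftrightarrow> dissects W D"
    by (rule dissects_insert_ear[OF ear])
  show "quiddity_of W D = map (degree W D) us @ [degree W D i, degree W D j] @ map (degree W D) vs"
    unfolding quiddity_of_def by (subst W_def, subst sorted_list_of_set_eqI[OF sW]) simp
  have deg: "degree V (insert (i, j) D) v = (if v \<in> {i, j} \<union> set bs then Suc (degree W D v) else degree W D v)" for v
    by (rule degree_insert_ear[OF ear])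
  have "map (degree V (insert (i, j) D)) us = map (degree W D) us"
    "map (degree V (insert (i, j) D)) vs = map (degree W D) vs"
    unfolding map_eq_conv deg using dist by auto
  moreover have "map (degree V (insert (i, j) D)) bs = replicate (length bs) 1"
    using degree_outside[OF ear] by (simp add: deg map_replicate_const[symmetric])
  moreover have "degree V (insert (i, j) D) i = Suc (degree W D i)"
    "degree V (insert (i, j) D) j = Suc (degree W D j)"
    by (simp_all add: deg)
  ultimately show "quiddity_of V (insert (i, j) D) = map (degree W D) us @ [Suc (degree W D i)] @
      replicate (length bs) 1 @ [Suc (degree W D j)] @ map (degree W D) vs"
    unfolding quiddity_of_def by (subst V_def, subst sorted_list_of_set_eqI[OF sorted]) simp
qed

lemma quiddity_of_empty: "3 \<le> card V \<Longrightarrow> quiddity_of V {} = replicate (card V) 1"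
  unfolding quiddity_of_def degree_def cells_of_empty
  by (rule replicate_eqI) (auto simp: card_ge_0_finite Collect_conv_if)

lemma run_replicate_3: "run (replicate (3 * t) 1) [0] = [0]"
  using rotU_power_mult_3[of "[0]" t] by (simp add: run_replicate_1 valid_stack_def)

lemma ex_ear:
  assumes V: "finite V" and D: "dissects V D" "D \<noteq> {}"
  obtains us i bs j vs D' where "sorted_wrt (<) (us @ [i] @ bs @ [j] @ vs)" "V = set (us @ [i] @ bs @ [j] @ vs)"
    "bs \<noteq> []" "us \<noteq> [] \<or> vs \<noteq> []" "D' \<subseteq> chords (set (us @ [i, j] @ vs))" "(i, j) \<notin> D'" "D = insert (i, j) D'"
proof -
  obtain c0 where "c0 \<in> D" using D(2) by blast
  \<comment> \<open>A diagonal of shortest span cuts off an ear: a chord ending strictly between its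
    ends would cross it or be shorter.\<close>
  then obtain c where c: "c \<in> D" "\<forall>d. d \<in> D \<longrightarrow> snd c - fst c \<le> snd d - fst d"
    using ex_has_least_nat[of "\<lambda>c. c \<in> D" c0 "\<lambda>c. snd c - fst c"] by blast
  obtain i j where "c = (i, j)" by (cases c)
  with c have ij: "(i, j) \<in> D" and min: "\<And>k l. (k, l) \<in> D \<Longrightarrow> j - i \<le> l - k"
    by fastforce+
  have sub: "D \<subseteq> diagonals V" using D by (simp add: dissects_def)
  have ijV: "i \<in> V" "j \<in> V" "i < j" "V \<inter> {i<..<j} \<noteq> {}" "\<not> V \<subseteq> {i..j}"
    using sub ij by (auto simp: mem_diagonals)
  define us bs vs where "us = sorted_list_of_set (V \<inter> {..<i})"
    and "bs = sorted_list_of_set (V \<inter> {i<..<j})" and "vs = sorted_list_of_set (V \<inter> {j<..})"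
  have sets: "set us = V \<inter> {..<i}" "set bs = V \<inter> {i<..<j}" "set vs = V \<inter> {j<..}"
    using V by (simp_all add: us_def bs_def vs_def)
  have 1: "sorted_wrt (<) (us @ [i] @ bs @ [j] @ vs)"
    using ijV(3) by (auto simp: sorted_wrt_append sets) (auto simp: us_def bs_def vs_def)
  have 2: "V = set (us @ [i] @ bs @ [j] @ vs)" using ijV by (auto simp: sets)
  have 3: "bs \<noteq> []" using sets(2) ijV(4) by force
  have 4: "us \<noteq> [] \<or> vs \<noteq> []"
  proof (rule ccontr)
    assume "\<not> ?thesis"
    then have "V \<subseteq> {i..j}" using sets by (auto simp: not_less[symmetric] disjoint_iff)
    with ijV(5) show False ..
  qed
  have "k \<notin> {i<..<j} \<and> l \<notin> {i<..<j}" if kl: "(k, l) \<in> D" for k l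
  proof -
    have "\<not> crossing (i, j) (k, l)" using D ij kl unfolding dissects_def by blast
    moreover have "k < l" using sub kl by (auto simp: mem_diagonals)
    ultimately show ?thesis using min[OF kl] ijV(3) by auto
  qed
  then have 5: "D - {(i, j)} \<subseteq> chords (set (us @ [i, j] @ vs))"
    using sub by (fastforce simp: mem_diagonals mem_chords sets)
  show ?thesis using that[OF 1 2 3 4 5] ij by blast
qed

text \<open>Induction by removing an ear with r new vertices: the sum drops by r + 2, the number of
  vertices by r, the number of cells by 1. So m cells give the excess 2(m-1).\<close>

lemma quiddity_of_properties:
  assumes "finite V" "3 \<le> card V" "dissects V D" "\<forall>C\<in>cells_of V D. 3 dvd card C"
  shows "(\<forall>x\<in>set (quiddity_of V D). x > 0) \<and>
    sum_list (quiddity_of V D) + 2 = card V + 2 * card (cells_of V D) \<and> run (quiddity_of V D) [0] = [0]"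
  using assms
proof (induction "card V" arbitrary: V D rule: less_induct)
  case less
  show ?case
  proof (cases "D = {}")
    case True
    then have "3 dvd card V" using less.prems by (simp add: cells_of_empty)
    then obtain t where "card V = 3 * t" by blast
    then show ?thesis
      using run_replicate_3[of t] less.prems(2) True
      by (simp add: quiddity_of_empty cells_of_empty sum_list_replicate)
  next
    case False
    then obtain us i bs j vs D' where s: "sorted_wrt (<) (us @ [i] @ bs @ [j] @ vs)"
      and V: "V = set (us @ [i] @ bs @ [j] @ vs)"
      and ne: "bs \<noteq> []" "us \<noteq> [] \<or> vs \<noteq> []"
      and D': "D' \<subseteq> chords (set (us @ [i, j] @ vs))" "(i, j) \<notin> D'" and D: "D = insert (i, j) D'"
      using ex_ear[OF less.prems(1,3)] by metis
    define W where "W = set (us @ [i, j] @ vs)"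
    note ear = quiddity_of_insert_ear[OF s ne D', folded V W_def D]
    have cV: "card V = length us + length bs + length vs + 2"
      unfolding V using s strict_sorted_iff by (subst distinct_card) (blast, simp)
    have "card W < card V" using ne(1) unfolding cV ear(7) by simp
    moreover have "3 \<le> card W" using ne(2) unfolding ear(7) by (cases us; cases vs) auto
    moreover have "dissects W D'" "\<forall>C\<in>cells_of W D'. 3 dvd card C" using less.prems ear(3,5) by auto
    ultimately have IH: "\<forall>x\<in>set (quiddity_of W D'). x > 0"
      "sum_list (quiddity_of W D') + 2 = card W + 2 * card (cells_of W D')" "run (quiddity_of W D') [0] = [0]"
      using less.hyps[of W D'] by (auto simp: W_def)
    have "3 dvd length bs + 2" using less.prems(4) ear(3,6) by auto
    then have "length bs mod 3 = 1" by presburger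
    then obtain t where t: "length bs = 3 * t + 1" by (metis div_mult_mod_eq mult.commute)
    have pos: "degree W D' i > 0" "degree W D' j > 0" using IH(1) unfolding ear(1) by auto
    have "run (quiddity_of V D) [0] = [0]"
      using IH(3) run_ear[of "[0]" "degree W D' i" "degree W D' j" "map (degree W D') us" t "map (degree W D') vs"] pos
      unfolding ear(1,2) t by (simp only: valid_stack_def) simp
    moreover have "\<forall>x\<in>set (quiddity_of V D). x > 0" using IH(1) unfolding ear(1,2) by auto
    moreover have "sum_list (quiddity_of V D) + 2 = card V + 2 * card (cells_of V D)"
      using IH(2) unfolding ear(1,2,4,7) cV by (simp add: sum_list_replicate)
    ultimately show ?thesis by blast
  qed
qed

text \<open>Shorten the word at an ear, realise the shorter word by induction, and glue the cell
  back at the corresponding vertices.\<close>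

lemma ex_dissection_with_quiddity:
  assumes "\<forall>x\<in>set a. x > 0" "run a [0] = [0]" "3 \<le> length a" "finite V" "card V = length a"
  shows "\<exists>D. dissects V D \<and> (\<forall>C\<in>cells_of V D. 3 dvd card C) \<and> quiddity_of V D = a"
  using assms
proof (induction "length a" arbitrary: a V rule: less_induct)
  case less
  from run_trivial_cases[OF less.prems(1,2)] show ?case
  proof (elim disjE conjE)
    assume a: "3 dvd length a" "a = replicate (length a) 1"
    have "3 \<le> card V" using less.prems(3,5) by simp
    then have "dissects V {}" "\<forall>C\<in>cells_of V {}. 3 dvd card C" "quiddity_of V {} = a"
      using a(1) a(2)[symmetric] less.prems(5)
      by (simp_all add: dissects_def cells_of_empty quiddity_of_empty)
    then show ?thesis by blast
  next
    assume "has_ear a"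
    then obtain xs p t q ys where pq: "p > 0" "q > 0"
      and a: "a = xs @ [Suc p] @ replicate (3 * t + 1) 1 @ [Suc q] @ ys"
      unfolding has_ear_def by blast
    define a' where "a' = xs @ [p, q] @ ys"
    have "run a [0] = run a' [0]"
      unfolding a a'_def by (rule run_ear) (use pq in \<open>simp_all add: valid_stack_def\<close>)
    then have run': "run a' [0] = [0]" using less.prems(2) by simp
    have pos': "\<forall>x\<in>set a'. x > 0" 
    proof
      fix x assume "x \<in> set a'"
      then have "x = p \<or> x = q \<or> x \<in> set a" unfolding a a'_def by fastforce
      then show "x > 0" using less.prems(1) pq by blast
    qed
    \<comment> \<open>The shortened word is again trivial: it contains an ear, or its positive
      length is a multiple of 3.\<close>
    have len': "3 \<le> length a'"
      using run_trivial_cases[OF pos' run']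
    proof (elim disjE conjE)
      assume "3 dvd length a'"
      then show ?thesis by (rule dvd_imp_le) (simp add: a'_def)
    qed (auto simp: has_ear_def)
    define l where "l = sorted_list_of_set V"
    have l: "sorted_wrt (<) l" "set l = V" "length l = length a"
      using less.prems(4,5) by (simp_all add: l_def)
    define us i bs j vs where "us = take (length xs) l" and "i = l ! length xs"
      and "bs = take (3 * t + 1) (drop (Suc (length xs)) l)"
      and "j = l ! (length xs + 3 * t + 2)" and "vs = drop (length xs + 3 * t + 3) l"
    have split: "l = us @ [i] @ bs @ [j] @ vs"
    proof -
      have "l = us @ drop (length xs) l" by (simp add: us_def)
      also have "drop (length xs) l = i # drop (Suc (length xs)) l"
        unfolding i_def using l(3) a by (intro Cons_nth_drop_Suc[symmetric]) simp
      also have "drop (Suc (length xs)) l = bs @ drop (length xs + 3 * t + 2) l"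
      proof -
        have "length xs + 3 * t + 2 = (3 * t + 1) + Suc (length xs)" by simp
        then have "drop (length xs + 3 * t + 2) l = drop (3 * t + 1) (drop (Suc (length xs)) l)"
          by (simp only: drop_drop)
        then show ?thesis unfolding bs_def by (simp only: append_take_drop_id)
      qed
      also have "drop (length xs + 3 * t + 2) l = j # vs"
        unfolding j_def vs_def using l(3) a
        by (subst Cons_nth_drop_Suc[symmetric]) (simp_all add: numeral_3_eq_3)
      finally show ?thesis by simp
    qed
    have lens: "length us = length xs" "length bs = 3 * t + 1" "length vs = length ys"
      unfolding us_def bs_def vs_def using l(3) a by simp_all
    have s: "sorted_wrt (<) (us @ [i] @ bs @ [j] @ vs)" and V: "V = set (us @ [i] @ bs @ [j] @ vs)"
      using l split by simp_all
    have ne: "bs \<noteq> []" "us \<noteq> [] \<or> vs \<noteq> []"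
      using lens len' by (auto simp: a'_def)
    define W where "W = set (us @ [i, j] @ vs)"
    have sW: "sorted_wrt (<) (us @ [i, j] @ vs)" using s by (auto simp: sorted_wrt_append)
    have cW: "card W = length a'"
      unfolding W_def using sW strict_sorted_iff lens by (subst distinct_card) (blast, simp add: a'_def)
    have "length a' < length a" by (simp add: a a'_def)
    then obtain D where D: "dissects W D" "\<forall>C\<in>cells_of W D. 3 dvd card C" "quiddity_of W D = a'"
      using less.hyps[OF _ pos' run' len' _ cW] W_def by auto
    have sub: "D \<subseteq> diagonals W" using D(1) by (simp add: dissects_def)
    then have "D \<subseteq> chords (set (us @ [i, j] @ vs))" by (auto simp: W_def diagonals_def)
    \<comment> \<open>The chord (i, j) is a side of \<open>W\<close>, hence not in its
      dissection.\<close>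
    moreover have "(i, j) \<notin> D"
    proof
      assume "(i, j) \<in> D"
      with sub have "W \<inter> {i<..<j} \<noteq> {}" by (auto simp: mem_diagonals)
      then show False using s by (auto simp: W_def sorted_wrt_append)
    qed
    ultimately have D': "D \<subseteq> chords (set (us @ [i, j] @ vs))" "(i, j) \<notin> D" by blast+
    note ear = quiddity_of_insert_ear[OF s ne D', folded V W_def]
    have "map (degree W D) us = xs \<and> degree W D i = p \<and> degree W D j = q \<and> map (degree W D) vs = ys"
      using D(3) lens unfolding ear(1) a'_def by simp
    then have "quiddity_of V (insert (i, j) D) = a"
      unfolding ear(2) a lens by simp
    moreover have "dissects V (insert (i, j) D)" using D(1) ear(5) by blast
    moreover have "3 dvd card ({i, j} \<union> set bs)" unfolding ear(6) lens by presburger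
    then have "\<forall>C\<in>cells_of V (insert (i, j) D). 3 dvd card C" using D(2) unfolding ear(3) by blast
    ultimately show ?thesis by blast
  qed
qed

section \<open>The number of quiddities\<close>

lemma quiddity_eq: "quiddity n D = quiddity_of (polygon n) D"
proof -
  have "sorted_list_of_set (polygon n) = [0..<n + 2]"
  proof -
    have "polygon n = {0..<n + 2}" by (auto simp: polygon_def)
    then show ?thesis by (simp only: sorted_list_of_set_range)
  qed
  then show ?thesis
    unfolding quiddity_def quiddity_of_def degree_def cells_def cells_of_def by simp
qed

lemma Q_eq_card:
  assumes "n > 0" "m > 0"
  shows "Q n m = card (trivial_seqs [0] (n + 2) (2 * (m - 1)))"
proof -
  have V: "finite (polygon n)" "card (polygon n) = n + 2" "3 \<le> card (polygon n)"
    using assms by (simp_all add: polygon_def)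
  have iff: "dissection n D \<longleftrightarrow> dissects (polygon n) D" "cells n D = cells_of (polygon n) D" for D
    by (simp_all add: dissection_def dissects_def cells_def cells_of_def)
  have len: "length (quiddity_of (polygon n) D) = n + 2" for D
    using V by (simp add: quiddity_of_def)
  have "{quiddity n D | D. dissection n D \<and> three_periodic n D \<and> card (cells n D) = m}
    = trivial_seqs [0] (n + 2) (2 * (m - 1))" (is "?L = ?R")
  proof
    show "?L \<subseteq> ?R"
    proof safe
      fix D assume "dissection n D" "three_periodic n D" "m = card (cells n D)"
      then show "quiddity n D \<in> trivial_seqs [0] (n + 2) (2 * (card (cells n D) - 1))"
        using quiddity_of_properties[OF V(1,3), of D] assms(2) len[of D]
        unfolding three_periodic_def iff quiddity_eq V(2) trivial_seqs_def by auto
    qed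
    show "?R \<subseteq> ?L"
    proof
      fix a assume a: "a \<in> ?R"
      then have "\<forall>x\<in>set a. x > 0" "run a [0] = [0]" "3 \<le> length a" "card (polygon n) = length a"
        using assms V by (auto simp: trivial_seqs_def)
      from ex_dissection_with_quiddity[OF this(1-3) V(1) this(4)]
      obtain D where D: "dissects (polygon n) D" "\<forall>C\<in>cells_of (polygon n) D. 3 dvd card C"
        "quiddity_of (polygon n) D = a" by blast
      have "sum_list a + 2 = n + 2 + 2 * card (cells_of (polygon n) D)"
        using quiddity_of_properties[OF V(1,3) D(1,2)] D(3) V(2) by simp
      then have "card (cells_of (polygon n) D) = m"
        using a assms(2) unfolding trivial_seqs_def by (simp, linarith)
      then show "a \<in> ?L"
        using D unfolding three_periodic_def iff quiddity_eq by blast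
    qed
  qed
  then show ?thesis by (simp add: Q_def)
qed

text \<open>Without cells the quiddity would sum to n, less than its length n + 2.\<close>

lemma Q_0: assumes "n > 0" shows "Q n 0 = 0"
proof -
  have "False" if D: "dissection n D" "three_periodic n D" "card (cells n D) = 0" for D
  proof -
    have V: "finite (polygon n)" "card (polygon n) = n + 2" "3 \<le> card (polygon n)"
      using assms by (simp_all add: polygon_def)
    have "dissects (polygon n) D" "\<forall>C\<in>cells_of (polygon n) D. 3 dvd card C" "card (cells_of (polygon n) D) = 0"
      using D by (simp_all add: dissection_def dissects_def cells_def cells_of_def three_periodic_def)
    note * = quiddity_of_properties[OF V(1,3) this(1,2)] this(3)
    have "length (quiddity_of (polygon n) D) \<le> sum_list (quiddity_of (polygon n) D)"
      using * by (intro length_le_sum_list) blast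
    then show False using * V by (simp add: quiddity_of_def)
  qed
  then have "{quiddity n D | D. dissection n D \<and> three_periodic n D \<and> card (cells n D) = 0} = {}" by blast
  then show ?thesis unfolding Q_def by (simp only: card.empty)
qed

lemma Q_eq_sum:
  assumes "n > 0" "m > 0"
  shows "of_nat (Q n m) = (\<Sum>i | 3 * i < n. power_nth (3 * i + 2) (n - 1 - 3 * i) (m - 1))"
proof -
  obtain P where P: "P_equation P" using ex1_P_equation by blast
  show ?thesis
    using card_trivial_seqs_eq_gf[OF V_equation_if_P_equation[OF P], of "Suc n" "m - 1"] gf_0_nth[OF P, of n "m - 1"]
    unfolding Q_eq_card[OF assms] by simp
qed

theorem theorem2p11:
  shows "(\<exists>!P. P_equation P) \<and>
    (\<forall>P. P_equation P \<longrightarrow> (\<forall>n > 0.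
      (\<forall>m. \<not> (\<exists>k. 3 * k < n \<and> m = n - 3 * k) \<longrightarrow> fps_nth (fps_nth P n) m = 0 \<and> Q n m = 0) \<and>
      (\<forall>k. 3 * k < n \<longrightarrow>
        fps_nth (fps_nth P n) (n - 3 * k) =
          1 / of_nat (n - k + 1) * of_nat ((n - 2 * k - 1) choose k) *
            of_nat ((2 * n - 4 * k) choose (n - 3 * k)) \<and>
        (of_nat (Q n (n - 3 * k)) :: rat) =
          (\<Sum>s = 0..k. of_nat (3 * (k - s) + 2) / of_nat (n - s + 1) *
            of_nat ((n - 3 * k + s - 2) choose s) *
            of_nat ((2 * n - 3 * k - s - 1) choose (n - 3 * k - 1))))))"
proof (intro conjI allI impI)
  show "\<exists>!P. P_equation P" by (rule ex1_P_equation)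
next
  fix P :: "rat fps fps" and n m :: nat
  assume P: "P_equation P" and n: "0 < n" and m: "\<not> (\<exists>k. 3 * k < n \<and> m = n - 3 * k)"
  have "m = n - 3 * ((n - m) div 3)" if "m \<le> n" "3 dvd (n - m)" using that by simp
  \<comment> \<open>For \<open>m > 0\<close> the quotient of n - m by 3 would be an admissible k;
    \<open>m = 0\<close> is the other way to leave the support.\<close>
  then have nondvd: "m = 0 \<or> \<not> m \<le> n \<or> \<not> 3 dvd (n - m)" using m by (metis gr0I zero_less_diff)
  have "power_nth 1 n m = 0"
    using nondvd n by (auto simp: power_nth_def power_coeff_def)
  then show "P $ n $ m = 0" using P_power_nth[OF P, of 1 n m] by simp
next
  fix P :: "rat fps fps" and n m :: nat
  assume P: "P_equation P" and n: "0 < n" and m: "\<not> (\<exists>k. 3 * k < n \<and> m = n - 3 * k)"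
  show "Q n m = 0"
  proof (cases "m = 0")
    case False
    have "power_nth (3 * i + 2) (n - 1 - 3 * i) (m - 1) = 0" if i: "3 * i < n" for i
    proof (rule ccontr)
      assume "power_nth (3 * i + 2) (n - 1 - 3 * i) (m - 1) \<noteq> 0"
      then have "m - 1 \<le> n - 1 - 3 * i" "3 dvd (n - 1 - 3 * i - (m - 1))"
        unfolding power_nth_def by meson+
      then obtain l where "n - 1 - 3 * i - (m - 1) = 3 * l" "m - 1 \<le> n - 1 - 3 * i" by blast
      then have "n - 1 = 3 * i + 3 * l + (m - 1)" using i by linarith
      then have "n = m + 3 * (i + l)" using False n by simp
      then have "m = n - 3 * (i + l)" "3 * (i + l) < n" using False by simp_all
      with m show False by blast
    qed
    then have "(of_nat (Q n m) :: rat) = 0" unfolding Q_eq_sum[OF n False[unfolded neq0_conv]] by simp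
    then show ?thesis by simp
  qed (simp add: Q_0[OF n])
next
  fix P :: "rat fps fps" and n k :: nat
  assume P: "P_equation P" and n: "0 < n" and k: "3 * k < n"
  define m where "m = n - 3 * k"
  have nm: "n = m + 3 * k" "m > 0" using k by (simp_all add: m_def)
  have "power_nth 1 n m = power_coeff 1 m k" by (simp add: power_nth_def nm)
  then have "P $ n $ m = power_coeff 1 m k" using P_power_nth[OF P, of 1 n m] by simp
  also have "\<dots> = 1 / of_nat (n - k + 1) * of_nat ((n - 2 * k - 1) choose k) *
      of_nat ((2 * n - 4 * k) choose m)"
  proof -
    have "1 + m + 2 * k = n - k + 1" "m + k - 1 = n - 2 * k - 1" "1 + 2 * m + 2 * k - 1 = 2 * n - 4 * k"
      by (simp_all add: nm)
    then show ?thesis by (subst power_coeff_eq) (simp_all only: of_nat_1 zero_less_one)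
  qed
  finally show "P $ n $ (n - 3 * k) = 1 / of_nat (n - k + 1) * of_nat ((n - 2 * k - 1) choose k) *
      of_nat ((2 * n - 4 * k) choose (n - 3 * k))" unfolding m_def .
next
  fix P :: "rat fps fps" and n k :: nat
  assume P: "P_equation P" and n: "0 < n" and k: "3 * k < n"
  define m where "m = n - 3 * k"
  have nm: "n = m + 3 * k" "m > 0" using k by (simp_all add: m_def)
  \<comment> \<open>With n = m + 3k, the power of exponent 3i + 2 must supply z^(m-1+3(k-i))
    w^(m-1), which is impossible for i > k.\<close>
  have coeff: "power_nth (3 * i + 2) (n - 1 - 3 * i) (m - 1) =
      (if i \<le> k then power_coeff (3 * i + 2) (m - 1) (k - i) else 0)" if "3 * i < n" for i
  proof (cases "i \<le> k")
    case True
    then have "n - 1 - 3 * i = (m - 1) + 3 * (k - i)" using nm by simp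
    then show ?thesis using True by (simp add: power_nth_def)
  next
    case False
    then have "\<not> m - 1 \<le> n - 1 - 3 * i" using nm that by linarith
    then show ?thesis using False unfolding power_nth_def by auto
  qed
  have "of_nat (Q n m) = (\<Sum>i | 3 * i < n. power_nth (3 * i + 2) (n - 1 - 3 * i) (m - 1))"
    by (rule Q_eq_sum[OF n nm(2)])
  also have "\<dots> = (\<Sum>i\<in>{0..k}. power_coeff (3 * i + 2) (m - 1) (k - i))"
  proof (rule sum.mono_neutral_cong_right)
    show "finite {i. 3 * i < n}" by (rule finite_subset[of _ "{..n}"]) auto
  qed (use coeff k in auto)
  \<comment> \<open>Reverse the summation by s = k - i to match the stated sum.\<close>
  also have "\<dots> = (\<Sum>s\<in>{0..k}. power_coeff (3 * (k - s) + 2) (m - 1) s)"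
    by (rule sum.reindex_bij_witness[of _ "\<lambda>s. k - s" "\<lambda>s. k - s"]) auto
  also have "\<dots> = (\<Sum>s = 0..k. of_nat (3 * (k - s) + 2) / of_nat (n - s + 1) *
            of_nat ((n - 3 * k + s - 2) choose s) *
            of_nat ((2 * n - 3 * k - s - 1) choose (n - 3 * k - 1)))"
  proof (rule sum.cong[OF refl])
    fix s assume s: "s \<in> {0..k}"
    then have "3 * (k - s) + 2 + (m - 1) + 2 * s = n - s + 1" "m - 1 + s - 1 = n - 3 * k + s - 2"
      "3 * (k - s) + 2 + 2 * (m - 1) + 2 * s - 1 = 2 * n - 3 * k - s - 1" "m - 1 = n - 3 * k - 1"
      using nm by auto
    then show "power_coeff (3 * (k - s) + 2) (m - 1) s = of_nat (3 * (k - s) + 2) / of_nat (n - s + 1) *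
            of_nat ((n - 3 * k + s - 2) choose s) *
            of_nat ((2 * n - 3 * k - s - 1) choose (n - 3 * k - 1))"
      by (subst power_coeff_eq) (simp, simp only:)
  qed
  finally show "of_nat (Q n (n - 3 * k)) = (\<Sum>s = 0..k. of_nat (3 * (k - s) + 2) / of_nat (n - s + 1) *
            of_nat ((n - 3 * k + s - 2) choose s) *
            of_nat ((2 * n - 3 * k - s - 1) choose (n - 3 * k - 1)) :: rat)" unfolding m_def .
qed

end
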